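(* The set of adjacency graphs of convex-polyhedral surfaces in $\mathbb{R}^3$ is closed under taking subgraphs and subdivisions. That is, if $G$ is isomorphic to the adjacency graph of a convex-polyhedral surface in $\mathbb{R}^3$, then so is every subgraph of $G$ and every subdivision of $G$.
   Context: Graphs are finite, simple and undirected. A polygon in $\mathbb{R}^3$ is a closed planar region (including its interior) bounded by a simple closed polygonal chain lying in some plane of $\mathbb{R}^3$; its vertices are called corners and its edges are called sides. A polyhedral surface $\mathcal{S}=\{S_1,\dots,S_n\}$ is a set of $n$ closed polygons embedded in $\mathbb{R}^3$ such that, for all pairwise distinct indices $i,j,k$: (1) $S_i$ and $S_j$ are interior-disjoint (with respect to the 2D relative interiors); (2) if $S_i\cap S_j\neq\emptyset$, then $S_i\cap S_j$ is either a single corner or a complete side of both $S_i$ and $S_j$; (3) if $S_i\cap S_j\cap S_k\neq\emptyset$, then it is a single corner (so a side is shared by at most two polygons). Sides need not be shared with another polygon. The adjacency graph $\mathcal{G}(\mathcal{S})$ has one vertex for each polygon of $\mathcal{S}$ and an edge between two vertices if and only if the corresponding polygons share a side (contacts in a single corner do not give an edge). A convex-polyhedral surface is a polyhedral surface all of whose polygons are strictly convex. A subdivision of a graph is obtained by replacing edges by internally disjoint paths. *)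

theory Defs
  imports
    "Graph_Theory.Subdivision"
    "Graph_Theory.Digraph_Isomorphism"
    "HOL-Analysis.Analysis"
begin

text \<open>A polygon is given by the cyclic sequence of its corners. Rotating or reversing the list
  yields the same polygon; indices are read modulo the length.\<close>

type_synonym corners = "(real ^ 3) list"

definition corner :: "corners \<Rightarrow> nat \<Rightarrow> real ^ 3" where
  "corner p i = p ! (i mod length p)"

definition side :: "corners \<Rightarrow> nat \<Rightarrow> (real ^ 3) set" where
  "side p i = closed_segment (corner p i) (corner p (Suc i))"

definition sides :: "corners \<Rightarrow> (real ^ 3) set set" where
  "sides p = side p ` {..<length p}"

text \<open>The last conjunct says that the closed chain is simple: distinct sides meet only in a common
  endpoint, so consecutive sides meet in exactly one point and all other pairs of sides are
  disjoint.\<close>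

definition polygon :: "corners \<Rightarrow> bool" where
  "polygon p \<longleftrightarrow>
     3 \<le> length p \<and> distinct p \<and> aff_dim (set p) = 2 \<and>
     (\<forall>i<length p. \<forall>j<length p. i \<noteq> j \<longrightarrow>
        side p i \<inter> side p j =
        {corner p i, corner p (Suc i)} \<inter> {corner p j, corner p (Suc j)})"

text \<open>The closed planar region bounded by the chain: the chain itself together with the bounded
  connected components of its complement in the plane spanned by the corners. The library's
  \<^const>\<open>inside\<close> takes the complement in the whole space and would be empty here.\<close>

definition region :: "corners \<Rightarrow> (real ^ 3) set" where
  "region p =
     (let C = \<Union> (sides p); E = affine hull (set p) - C
      in C \<union> {x \<in> E. bounded (connected_component_set E x)})"

text \<open>Interior angles of a convex polygon are at most \<open>\<pi>\<close>; non-collinearity of consecutive corners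
  excludes the straight ones.\<close>

definition strictly_convex :: "corners \<Rightarrow> bool" where
  "strictly_convex p \<longleftrightarrow>
     convex (region p) \<and>
     (\<forall>i<length p. \<not> collinear {corner p i, corner p (i + 1), corner p (i + 2)})"

text \<open>Two corner lists of the same polygon cannot both belong to a surface, since their relative
  interiors would meet. The empty surface is allowed.\<close>

definition polyhedral_surface :: "corners set \<Rightarrow> bool" where
  "polyhedral_surface S \<longleftrightarrow>
     finite S \<and> (\<forall>p\<in>S. polygon p) \<and>
     (\<forall>p\<in>S. \<forall>q\<in>S. p \<noteq> q \<longrightarrow>
        rel_interior (region p) \<inter> rel_interior (region q) = {}) \<and>
     (\<forall>p\<in>S. \<forall>q\<in>S. p \<noteq> q \<longrightarrow> region p \<inter> region q \<noteq> {} \<longrightarrow>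
        (\<exists>c \<in> set p \<inter> set q. region p \<inter> region q = {c}) \<or>
        region p \<inter> region q \<in> sides p \<inter> sides q) \<and>
     (\<forall>p\<in>S. \<forall>q\<in>S. \<forall>r\<in>S. p \<noteq> q \<longrightarrow> p \<noteq> r \<longrightarrow> q \<noteq> r \<longrightarrow>
        region p \<inter> region q \<inter> region r \<noteq> {} \<longrightarrow>
        (\<exists>c \<in> set p \<inter> set q \<inter> set r. region p \<inter> region q \<inter> region r = {c}))"

definition convex_polyhedral_surface :: "corners set \<Rightarrow> bool" where
  "convex_polyhedral_surface S \<longleftrightarrow> polyhedral_surface S \<and> (\<forall>p\<in>S. strictly_convex p)"

text \<open>A finite simple undirected graph is a \<^locale>\<open>pair_graph\<close>: an edge between two vertices is
  the pair of opposite arcs.\<close>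

definition adjacency_graph :: "corners set \<Rightarrow> corners pair_pre_digraph" where
  "adjacency_graph S =
     \<lparr>pverts = S, parcs = {(p, q). p \<in> S \<and> q \<in> S \<and> p \<noteq> q \<and> sides p \<inter> sides q \<noteq> {}}\<rparr>"

definition convex_surface_graph :: "'a pair_pre_digraph \<Rightarrow> bool" where
  "convex_surface_graph G \<longleftrightarrow>
     (\<exists>S. convex_polyhedral_surface S \<and>
          digraph_iso (with_proj G) (with_proj (adjacency_graph S)))"

end

theory Submission
  imports Defs
begin

text \<open>A polygon is strictly convex iff every side lies on a line with all other corners strictly on one
  side, and then its region is the convex hull of its corners. Cutting off all corners of a surface
  at a small common ratio \<open>e\<close> along the sides keeps shared sides shared and destroys all other
  contacts, so that afterwards no three polygons meet. If \<open>p\<close> and \<open>q\<close> now share a side \<open>s\<close>, the sides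
  of \<open>p\<close> adjacent to \<open>s\<close> are not shared. Hence \<open>p\<close> can be cut along a parallel to \<open>s\<close> into a thin strip
  \<open>R\<close> at \<open>s\<close> and a remainder \<open>p'\<close> without affecting any other contact. Replacing \<open>p\<close> by \<open>p'\<close> and \<open>R\<close>
  subdivides the edge \<open>pq\<close>; dropping \<open>R\<close> as well deletes it.\<close>

section \<open>Polygons with corners in strictly convex position\<close>

text \<open>A cut off the side \<open>s\<close> splits the two sides of \<open>p\<close> next to
  \<open>s\<close>. If one of them were shared with a third polygon, neither piece would be a
  complete side of that polygon any more. This is the obstacle that forces the truncation. Without
  triple points it cannot occur: a polygon on a side next to \<open>s\<close> would meet
  \<open>p\<close> and \<open>q\<close> in an end of \<open>s\<close>. The condition
  \<open>side_surface\<close> reached by truncating survives every later cut, so deletions and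
  subdivisions can be iterated without truncating again. Under it, adjacency is just nonempty
  intersection of hulls. The new corners on a side with ends \<open>x\<close> and \<open>y\<close>
  lie at ratio \<open>e\<close> from either end. This rule refers neither to a polygon nor to an
  orientation, hence both polygons at a shared side shorten it to the same segment. Regions matter
  only on entering and leaving the argument. In between, polygons are described by linear
  functionals evaluated at finitely many corners, so that new polygons can be verified by
  computation instead of topology.\<close>

abbreviation conv :: "corners \<Rightarrow> (real ^ 3) set" where
  "conv p \<equiv> convex hull (set p)"

section \<open>Cyclic indexing of corners and sides\<close>

lemma corner_mod [simp]: "corner p (i mod length p) = corner p i"
  by (simp add: corner_def)

lemma corner_add_mult_length [simp]: "corner p (i + length p * m) = corner p i"
  by (simp add: corner_def)

lemma corner_nth: "i < length p \<Longrightarrow> corner p i = p ! i"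
  by (simp add: corner_def)

lemma corner_in_set: "0 < length p \<Longrightarrow> corner p i \<in> set p"
  by (simp add: corner_def)

lemma in_set_corner: "x \<in> set p \<Longrightarrow> \<exists>i<length p. x = corner p i"
  by (metis corner_nth in_set_conv_nth)

lemma corner_eq_iff:
  "distinct p \<Longrightarrow> 0 < length p \<Longrightarrow> corner p i = corner p j \<longleftrightarrow> i mod length p = j mod length p"
  by (simp add: corner_def nth_eq_iff_index_eq)

lemma side_mod [simp]: "side p (i mod length p) = side p i"
proof -
  have "Suc (i mod length p) mod length p = Suc i mod length p"
    by (simp add: mod_Suc_eq)
  then show ?thesis
    unfolding side_def by (metis corner_mod)
qed

lemma side_add_mult_length [simp]: "side p (i + length p * m) = side p i"
  by (metis mod_mult_self2 side_mod)

lemma side_in_sides: "0 < length p \<Longrightarrow> side p i \<in> sides p"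
  unfolding sides_def by (metis image_eqI lessThan_iff mod_less_divisor side_mod)

lemma corner_in_side: "corner p i \<in> side p i" "corner p (Suc i) \<in> side p i"
  by (auto simp: side_def)

lemma side_subset_conv: "0 < length p \<Longrightarrow> side p i \<subseteq> conv p"
  unfolding side_def by (meson closed_segment_subset_convex_hull corner_in_set hull_inc)

lemma sides_subset_conv: "\<Union>(sides p) \<subseteq> conv p"
  unfolding sides_def using side_subset_conv by (cases "length p = 0") fastforce+

lemma set_subset_sides: "set p \<subseteq> \<Union>(sides p)"
proof
  fix x assume "x \<in> set p"
  then obtain i where "i < length p" "x = corner p i"
    using in_set_corner by blast
  then show "x \<in> \<Union>(sides p)"
    unfolding sides_def using corner_in_side by blast
qed

text \<open>The contact set is a face, and a face of the hull of a finite set is the hull of some of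
  its points. Intersections with supporting lines can thus be read off from the corners
  alone.\<close>

lemma convex_hull_Int_supporting_hyperplane:
  fixes V :: "'a::euclidean_space set"
  assumes "finite V" and le: "\<And>x. x \<in> V \<Longrightarrow> a \<bullet> x \<le> b"
  shows "x \<in> convex hull V \<Longrightarrow> a \<bullet> x \<le> b"
    and "convex hull V \<inter> {x. a \<bullet> x = b} = convex hull {x \<in> V. a \<bullet> x = b}"
proof -
  have "convex hull V \<subseteq> {x. a \<bullet> x \<le> b}"
    by (intro hull_minimal) (auto simp: convex_halfspace_le le)
  then show le': "a \<bullet> x \<le> b" if "x \<in> convex hull V" for x
    using that by blast
  have "(convex hull V \<inter> {x. a \<bullet> x = b}) face_of convex hull V"
    using le' by (intro face_of_Int_supporting_hyperplane_le) auto
  then obtain W where W: "W \<subseteq> V" "convex hull V \<inter> {x. a \<bullet> x = b} = convex hull W"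
    using face_of_convex_hull_subset finite_imp_compact[OF \<open>finite V\<close>] by metis
  then have "W \<subseteq> {x \<in> V. a \<bullet> x = b}"
    using hull_subset[of W convex] by blast
  moreover have "convex hull {x \<in> V. a \<bullet> x = b} \<subseteq> convex hull V \<inter> {x. a \<bullet> x = b}"
    by (intro hull_minimal) (auto simp: convex_Int convex_hyperplane hull_inc)
  ultimately show "convex hull V \<inter> {x. a \<bullet> x = b} = convex hull {x \<in> V. a \<bullet> x = b}"
    using W(2) hull_mono[of W "{x \<in> V. a \<bullet> x = b}" convex] by simp
qed

text \<open>Each side is given by a linear functional whose maximum over the corners is attained at
  its two ends only. This also fixes the cyclic order of the corners. The index runs over all
  natural numbers, so no wrap-around has to be treated separately.\<close>

definition convex_corners :: "corners \<Rightarrow> bool" where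
  "convex_corners p \<longleftrightarrow>
     3 \<le> length p \<and> distinct p \<and> aff_dim (set p) = 2 \<and>
     (\<forall>i. \<exists>a b. \<forall>x\<in>set p.
        a \<bullet> x \<le> b \<and> (a \<bullet> x = b \<longleftrightarrow> x = corner p i \<or> x = corner p (Suc i)))"

lemma convex_cornersD:
  assumes "convex_corners p"
  shows "3 \<le> length p" "0 < length p" "distinct p" "aff_dim (set p) = 2"
  using assms by (auto simp: convex_corners_def)

lemma convex_corners_functional:
  assumes "convex_corners p"
  obtains a b where "\<And>x. x \<in> set p \<Longrightarrow> a \<bullet> x \<le> b"
    and "\<And>x. x \<in> set p \<Longrightarrow> a \<bullet> x = b \<longleftrightarrow> x = corner p i \<or> x = corner p (Suc i)"
  using assms unfolding convex_corners_def by meson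

lemma mod_ne_Suc_mod:
  fixes i n :: nat
  shows "2 \<le> n \<Longrightarrow> i mod n \<noteq> Suc i mod n"
    and "3 \<le> n \<Longrightarrow> i mod n \<noteq> Suc (Suc i) mod n"
  by (auto simp: mod_Suc split: if_splits)

lemma corner_neq:
  assumes "distinct p" "3 \<le> length p"
  shows "corner p i \<noteq> corner p (Suc i)" "corner p i \<noteq> corner p (Suc (Suc i))"
proof -
  have "0 < length p"
    using assms by linarith
  then show "corner p i \<noteq> corner p (Suc i)" "corner p i \<noteq> corner p (Suc (Suc i))"
    using mod_ne_Suc_mod[of "length p" i] assms corner_eq_iff[OF assms(1)] by simp_all
qed

lemma aff_dim_two_corners:
  fixes x y z :: "'a::euclidean_space"
  assumes "{x, y, z} \<subseteq> S" "x \<noteq> y" "a \<bullet> x = b" "a \<bullet> y = b" "a \<bullet> z \<noteq> b"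
  shows "\<not> collinear {x, y, z}" "aff_dim S \<ge> 2"
proof -
  have "affine hull {x, y} \<subseteq> {z. a \<bullet> z = b}"
    using assms by (intro hull_minimal) (auto simp: affine_hyperplane)
  then have "z \<notin> affine hull {x, y}"
    using assms by blast
  then show "\<not> collinear {x, y, z}"
    using collinear_3_affine_hull[OF \<open>x \<noteq> y\<close>] by blast
  then have "aff_dim {x, y, z} \<ge> 2"
    by (simp add: collinear_aff_dim)
  then show "aff_dim S \<ge> 2"
    using aff_dim_subset[OF assms(1)] by linarith
qed

text \<open>The criterion by which cut and truncated polygons are verified. Distinctness and the
  lower bound on the dimension come for free: the functional of a side is strictly smaller at every
  index other than its two ends.\<close>

lemma convex_cornersI:
  assumes n: "3 \<le> length p" and dim: "aff_dim (set p) \<le> 2"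
    and ab: "\<And>i. i < length p \<Longrightarrow> \<exists>a b. a \<bullet> p ! i = b \<and> a \<bullet> corner p (Suc i) = b \<and>
      (\<forall>k<length p. k \<noteq> i \<longrightarrow> k \<noteq> Suc i mod length p \<longrightarrow> a \<bullet> p ! k < b)"
  shows "convex_corners p"
proof -
  let ?n = "length p"
  have f: "\<exists>a b. \<forall>k. a \<bullet> corner p k \<le> b \<and>
      (a \<bullet> corner p k = b \<longleftrightarrow> k mod ?n = i mod ?n \<or> k mod ?n = Suc i mod ?n)" for i
  proof -
    have "i mod ?n < ?n"
      using n by (intro mod_less_divisor) linarith
    from ab[OF this] obtain a b where ab: "a \<bullet> p ! (i mod ?n) = b"
      "a \<bullet> corner p (Suc (i mod ?n)) = b"
      "\<forall>k<?n. k \<noteq> i mod ?n \<longrightarrow> k \<noteq> Suc (i mod ?n) mod ?n \<longrightarrow> a \<bullet> p ! k < b"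
      by blast
    have "a \<bullet> corner p k \<le> b \<and>
      (a \<bullet> corner p k = b \<longleftrightarrow> k mod ?n = i mod ?n \<or> k mod ?n = Suc i mod ?n)" for k
    proof -
      have "k mod ?n < ?n"
        using n by (intro mod_less_divisor) linarith
      then have "k mod ?n \<noteq> i mod ?n \<Longrightarrow> k mod ?n \<noteq> Suc i mod ?n \<Longrightarrow> a \<bullet> corner p k < b"
        using ab(3) by (simp add: corner_def mod_Suc_eq)
      then show ?thesis
        using ab(1,2) unfolding corner_def by (fastforce simp: mod_Suc_eq)
    qed
    then show ?thesis by blast
  qed
  \<comment> \<open>Equal corners at different indices lie on the lines of each other's sides. Each
    index would then be the successor of the other modulo \<open>?n\<close>, which is impossible for
    \<open>?n\<close> at least 3.\<close>
  have dist: "i mod ?n = j mod ?n" if eq: "corner p i = corner p j" for i j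
  proof (rule ccontr)
    assume ne: "i mod ?n \<noteq> j mod ?n"
    have one: "\<And>i j. corner p i = corner p j \<Longrightarrow> i mod ?n \<noteq> j mod ?n \<Longrightarrow> j mod ?n = Suc i mod ?n"
      using f by metis
    have "j mod ?n = Suc i mod ?n" "i mod ?n = Suc j mod ?n"
      using one[of i j] one[of j i] eq ne by auto
    then have "i mod ?n = Suc (Suc i) mod ?n"
      by (metis mod_Suc_eq)
    then show False
      using mod_ne_Suc_mod(2)[OF n] by blast
  qed
  have "distinct p"
    unfolding distinct_conv_nth by (metis corner_nth dist mod_less)
  moreover have "aff_dim (set p) \<ge> 2"
  proof -
    from f[of 0] obtain a b where ab: "\<And>k. a \<bullet> corner p k = b \<longleftrightarrow> k mod ?n = 0 mod ?n \<or> k mod ?n = Suc 0 mod ?n"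
      by blast
    have "0 < length p"
      using n by linarith
    then have "{corner p 0, corner p 1, corner p 2} \<subseteq> set p"
      by (simp add: corner_in_set)
    moreover have "corner p 0 \<noteq> corner p 1"
      using corner_neq(1)[OF \<open>distinct p\<close> n, of 0] by simp
    moreover have "a \<bullet> corner p 0 = b" "a \<bullet> corner p 1 = b" "a \<bullet> corner p 2 \<noteq> b"
      using n by (auto simp: ab)
    ultimately show ?thesis
      by (rule aff_dim_two_corners(2))
  qed
  moreover have "\<exists>a b. \<forall>x\<in>set p.
        a \<bullet> x \<le> b \<and> (a \<bullet> x = b \<longleftrightarrow> x = corner p i \<or> x = corner p (Suc i))" for i
  proof -
    obtain a b where ab: "\<And>k. a \<bullet> corner p k \<le> b \<and>
      (a \<bullet> corner p k = b \<longleftrightarrow> k mod ?n = i mod ?n \<or> k mod ?n = Suc i mod ?n)"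
      using f[of i] by blast
    have "a \<bullet> x \<le> b \<and> (a \<bullet> x = b \<longleftrightarrow> x = corner p i \<or> x = corner p (Suc i))" if x: "x \<in> set p" for x
    proof -
      obtain k where k: "x = corner p k" "k < ?n"
        using x in_set_corner by blast
      then have "0 < ?n"
        by linarith
      then show ?thesis
        unfolding k(1) corner_eq_iff[OF \<open>distinct p\<close> \<open>0 < ?n\<close>] using ab[of k] by blast
    qed
    then show ?thesis by blast
  qed
  ultimately show ?thesis
    using n dim unfolding convex_corners_def by auto
qed

section \<open>Sides as facets of the hull\<close>

lemma side_exposed:
  assumes "convex_corners p"
  obtains a b where "\<And>x. x \<in> conv p \<Longrightarrow> a \<bullet> x \<le> b" "conv p \<inter> {x. a \<bullet> x = b} = side p i"
    "\<And>x. x \<in> set p \<Longrightarrow> a \<bullet> x = b \<longleftrightarrow> x = corner p i \<or> x = corner p (Suc i)"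
proof -
  obtain a b where ab: "\<And>x. x \<in> set p \<Longrightarrow> a \<bullet> x \<le> b"
    "\<And>x. x \<in> set p \<Longrightarrow> a \<bullet> x = b \<longleftrightarrow> x = corner p i \<or> x = corner p (Suc i)"
    using convex_corners_functional[OF assms] by metis
  have eq: "{x \<in> set p. a \<bullet> x = b} = {corner p i, corner p (Suc i)}"
    using ab(2) corner_in_set[OF convex_cornersD(2)[OF assms]] by blast
  show thesis
  proof
    show "a \<bullet> x \<le> b" if "x \<in> conv p" for x
      using convex_hull_Int_supporting_hyperplane(1)[OF finite_set ab(1)] that by blast
    show "conv p \<inter> {x. a \<bullet> x = b} = side p i"
      using convex_hull_Int_supporting_hyperplane(2)[OF finite_set ab(1)]
      unfolding side_def segment_convex_hull eq[symmetric] by blast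
  qed (use ab in blast)
qed

lemma side_facet_of:
  assumes "convex_corners p"
  shows "side p i facet_of conv p"
proof -
  obtain a b where ab: "\<And>x. x \<in> conv p \<Longrightarrow> a \<bullet> x \<le> b" "conv p \<inter> {x. a \<bullet> x = b} = side p i"
    using side_exposed[OF assms] by metis
  have "side p i face_of conv p"
    unfolding ab(2)[symmetric]
    by (intro face_of_Int_supporting_hyperplane_le) (auto simp: ab(1))
  moreover have "aff_dim (side p i) = 1"
    using corner_neq(1)[OF convex_cornersD(3)[OF assms] convex_cornersD(1)[OF assms], of i]
    unfolding side_def segment_convex_hull aff_dim_convex_hull by simp
  ultimately show ?thesis
    using convex_cornersD(4)[OF assms] corner_in_side(1)[of p i]
    unfolding facet_of_def aff_dim_convex_hull by auto
qed

lemma side_neq_conv: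
  assumes "convex_corners p" "s \<in> sides p"
  shows "s \<noteq> conv p"
  using side_facet_of[OF assms(1)] assms(2) unfolding sides_def by (metis facet_of_irrefl imageE)

text \<open>Seen from a vertex \<open>v\<close>, the hull lies in the cone spanned by the two sides at \<open>v\<close>; a supporting
  line through \<open>v\<close> and a point inside this cone would contain the whole plane.\<close>

lemma facet_is_side:
  assumes p: "convex_corners p" and F: "F facet_of conv p"
  shows "F \<in> sides p"
proof -
  note pD = convex_cornersD[OF p]
  have cvx: "compact (conv p)" "convex (conv p)"
    by (auto simp: finite_imp_compact_convex_hull)
  have Ff: "F face_of conv p" "F \<noteq> {}" "aff_dim F = 1"
    using F pD(4) by (auto simp: facet_of_def aff_dim_convex_hull)
  then have "compact F" "convex F"
    using cvx by (auto intro: face_of_imp_compact face_of_imp_convex)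
  then obtain v where v: "v extreme_point_of F"
    using extreme_point_exists_convex \<open>F \<noteq> {}\<close> by blast
  then have "v \<in> set p" "v \<in> F"
    using extreme_point_of_face[OF Ff(1)] extreme_point_of_convex_hull by auto
  then obtain k where "k < length p" and k: "v = corner p k"
    using in_set_corner by blast
  \<comment> \<open>The predecessor of \<open>k\<close>, shifted by one full turn to avoid truncated
    subtraction at \<open>k = 0\<close>.\<close>
  define i where "i = k + (length p - 1)"
  have "Suc i = k + length p * 1"
    using pD(2) by (simp add: i_def)
  then have i: "v = corner p (Suc i)"
    using k by (metis corner_add_mult_length)
  define u where "u = corner p i"
  define w where "w = corner p (Suc (Suc i))"
  have uvw: "u \<noteq> v" "v \<noteq> w" "u \<noteq> w" "{v, u, w} \<subseteq> set p"
    using corner_neq[OF pD(3,1)] corner_in_set[OF pD(2)] by (auto simp: i u_def w_def)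
  obtain a b where ab: "\<And>x. x \<in> conv p \<Longrightarrow> a \<bullet> x \<le> b" "conv p \<inter> {x. a \<bullet> x = b} = side p i"
    "\<And>x. x \<in> set p \<Longrightarrow> a \<bullet> x = b \<longleftrightarrow> x = u \<or> x = v"
    by (rule side_exposed[OF p, of i, folded i u_def]) (rule that; blast)
  obtain a' b' where ab': "\<And>x. x \<in> conv p \<Longrightarrow> a' \<bullet> x \<le> b'"
    "conv p \<inter> {x. a' \<bullet> x = b'} = side p (Suc i)"
    "\<And>x. x \<in> set p \<Longrightarrow> a' \<bullet> x = b' \<longleftrightarrow> x = v \<or> x = w"
    by (rule side_exposed[OF p, of "Suc i", folded i w_def]) (rule that; blast)
  obtain c d where cd: "conv p \<subseteq> {x. c \<bullet> x \<le> d}" "F = conv p \<inter> {x. c \<bullet> x = d}"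
    using facet_of_polyhedron[OF polyhedron_convex_hull F] by (metis finite_set)
  have "aff_dim {v, u, w} \<ge> 2"
    using aff_dim_two_corners(2)[of v u w "{v, u, w}" a b] uvw ab(3) by blast
  then have aff: "affine hull {v, u, w} = affine hull (set p)"
    using pD(4) aff_dim_subset[OF uvw(4)]
    by (intro affine_dim_equal) (auto simp: hull_mono[OF uvw(4)])
  have "F \<noteq> {v}"
    using Ff(3) by auto
  then obtain z where z: "z \<in> F" "z \<noteq> v"
    using \<open>v \<in> F\<close> by blast
  then have zp: "z \<in> conv p" "c \<bullet> z = d"
    using cd by auto
  have cv: "c \<bullet> v = d"
    using \<open>v \<in> F\<close> cd by auto
  have "z \<in> affine hull {v, u, w}"
    using zp(1) convex_hull_subset_affine_hull aff by blast
  then obtain r s t where rst: "r + s + t = 1" "z = r *\<^sub>R v + s *\<^sub>R u + t *\<^sub>R w"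
    unfolding affine_hull_3 by blast
  have "z \<in> side p i \<or> z \<in> side p (Suc i)"
  proof (rule ccontr)
    assume "\<not> (z \<in> side p i \<or> z \<in> side p (Suc i))"
    then have lt: "a \<bullet> z < b" "a' \<bullet> z < b'"
      using ab(1)[OF zp(1)] ab'(1)[OF zp(1)] ab(2) ab'(2) zp(1) by (auto simp: less_le)
    have r: "r = 1 - s - t"
      using rst(1) by simp
    have eq: "a \<bullet> u = b" "a \<bullet> v = b" "a' \<bullet> v = b'" "a' \<bullet> w = b'" "a \<bullet> w < b" "a' \<bullet> u < b'"
    proof -
      have "u \<in> conv p" "w \<in> conv p" "u \<in> set p" "v \<in> set p" "w \<in> set p"
        using uvw(4) by (auto simp: hull_inc)
      then show "a \<bullet> u = b" "a \<bullet> v = b" "a' \<bullet> v = b'" "a' \<bullet> w = b'" "a \<bullet> w < b" "a' \<bullet> u < b'"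
        using ab(1)[of w] ab'(1)[of u] ab(3)[of u] ab(3)[of v] ab(3)[of w]
          ab'(3)[of u] ab'(3)[of v] ab'(3)[of w] uvw(1-3) by auto
    qed
    have "a \<bullet> z = b - t * (b - a \<bullet> w)" "a' \<bullet> z = b' - s * (b' - a' \<bullet> u)"
      by (simp_all add: rst(2) r inner_add_right eq algebra_simps)
    then have st: "t > 0" "s > 0"
      using lt eq by (simp_all add: zero_less_mult_iff)
    have "c \<bullet> z = d - s * (d - c \<bullet> u) - t * (d - c \<bullet> w)"
      by (simp add: rst(2) r inner_add_right cv algebra_simps)
    then have *: "s * (d - c \<bullet> u) + t * (d - c \<bullet> w) = 0"
      using zp(2) by simp
    have le: "c \<bullet> u \<le> d" "c \<bullet> w \<le> d"
      using cd(1) uvw(4) hull_subset[of "set p" convex] by auto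
    then have "s * (d - c \<bullet> u) = 0" "t * (d - c \<bullet> w) = 0"
      using * st mult_nonneg_nonneg[of s "d - c \<bullet> u"] mult_nonneg_nonneg[of t "d - c \<bullet> w"]
      by linarith+
    then have "{v, u, w} \<subseteq> F"
      using st cv cd(2) uvw(4) hull_subset[of "set p" convex] by auto
    then show False
      using aff_dim_subset[of "{v, u, w}" F] Ff(3) \<open>aff_dim {v, u, w} \<ge> 2\<close> by linarith
  qed
  then obtain j where j: "z \<in> side p j" "v \<in> side p j"
    using corner_in_side i by metis
  \<comment> \<open>Both \<open>F\<close> and the side are segments through \<open>v\<close> and
    \<open>z\<close>. Their intersection is a face of each and has dimension 1, whereas a proper
    face would have smaller dimension; hence they coincide.\<close>
  have "(F \<inter> side p j) face_of conv p"
    using Ff(1) side_facet_of[OF p] by (simp add: face_of_Int facet_of_imp_face_of)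
  then have face: "(F \<inter> side p j) face_of F" "(F \<inter> side p j) face_of side p j"
    using facet_of_imp_subset[OF F] facet_of_imp_subset[OF side_facet_of[OF p]]
    by (auto intro: face_of_subset)
  have "aff_dim {v, z} \<le> aff_dim (F \<inter> side p j)"
    using j z \<open>v \<in> F\<close> by (intro aff_dim_subset) auto
  then have ge: "aff_dim (F \<inter> side p j) \<ge> 1"
    using \<open>z \<noteq> v\<close> by auto
  have "aff_dim (side p j) = 1" "convex (side p j)"
    using side_facet_of[OF p, of j] pD(4) by (auto simp: facet_of_def aff_dim_convex_hull side_def)
  then have "F \<inter> side p j = F" "F \<inter> side p j = side p j"
    using face_of_aff_dim_lt[OF \<open>convex F\<close> face(1)] face_of_aff_dim_lt[OF _ face(2)] ge Ff(3)
    by linarith+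
  then show ?thesis
    using side_in_sides[OF pD(2)] by metis
qed

lemma rel_frontier_conv:
  assumes "convex_corners p"
  shows "rel_frontier (conv p) = \<Union>(sides p)"
proof -
  have "{F. F facet_of conv p} = sides p"
    using facet_is_side[OF assms] side_facet_of[OF assms] by (auto simp: sides_def)
  then show ?thesis
    by (simp add: rel_frontier_of_polyhedron polyhedron_convex_hull)
qed

section \<open>Regions of strictly convex polygons\<close>

text \<open>The ray that starts in \<open>x\<close> and points away from some \<open>z\<close> in
  \<open>K\<close> never meets \<open>K\<close>, since otherwise \<open>x\<close> would lie between
  two points of \<open>K\<close>. It is connected and unbounded and avoids \<open>C\<close>.\<close>

lemma unbounded_component_outside_convex:
  fixes K :: "'a::euclidean_space set"
  assumes "convex K" "K \<noteq> {}" "x \<in> affine hull K" "x \<notin> K" "C \<subseteq> K"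
  shows "\<not> bounded (connected_component_set (affine hull K - C) x)"
proof -
  obtain z where "z \<in> K"
    using assms by blast
  define ray where "ray = (\<lambda>t. x + t *\<^sub>R (x - z)) ` {0::real..}"
  have "ray \<inter> K = {}"
  proof (rule ccontr)
    assume "ray \<inter> K \<noteq> {}"
    then obtain t where t: "t \<ge> 0" "x + t *\<^sub>R (x - z) \<in> K"
      by (auto simp: ray_def)
    have "(1 / (1 + t)) *\<^sub>R (x + t *\<^sub>R (x - z)) + (t / (1 + t)) *\<^sub>R z \<in> K"
      using t \<open>z \<in> K\<close> \<open>convex K\<close> by (intro convexD) (auto simp: field_simps)
    also have "(1 / (1 + t)) *\<^sub>R (x + t *\<^sub>R (x - z)) + (t / (1 + t)) *\<^sub>R z = x"
      using t(1) by (simp add: algebra_simps flip: scaleR_add_left add_divide_distrib)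
    finally show False
      using \<open>x \<notin> K\<close> by simp
  qed
  moreover have "ray \<subseteq> affine hull K"
  proof -
    have "x + t *\<^sub>R (x - z) \<in> affine hull K" for t
    proof -
      have "(1 + t) *\<^sub>R x + (- t) *\<^sub>R z \<in> affine hull K"
        using assms(3) hull_inc[OF \<open>z \<in> K\<close>] affine_affine_hull by (intro mem_affine) auto
      then show ?thesis
        by (simp add: algebra_simps)
    qed
    then show ?thesis
      by (auto simp: ray_def)
  qed
  moreover have "topological_space_class.connected ray"
    unfolding ray_def by (intro connected_continuous_image continuous_intros) auto
  moreover have "x \<in> ray"
    unfolding ray_def by (rule image_eqI[of _ _ 0]) auto
  ultimately have sub: "ray \<subseteq> connected_component_set (affine hull K - C) x"
    using \<open>C \<subseteq> K\<close> by (intro connected_component_maximal) auto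
  have "\<not> bounded ray"
  proof
    assume "bounded ray"
    then obtain B where B: "\<And>y. y \<in> ray \<Longrightarrow> norm y \<le> B"
      unfolding bounded_iff by blast
    have "norm (x - z) > 0"
      using \<open>z \<in> K\<close> \<open>x \<notin> K\<close> by auto
    \<comment> \<open>Far enough along the ray for the norm to exceed the supposed bound
      \<open>B\<close> by at least 1.\<close>
    define t where "t = (B + norm x + 1) / norm (x - z)"
    have "B \<ge> 0"
      using B[OF \<open>x \<in> ray\<close>] norm_ge_zero order_trans by blast
    then have "t \<ge> 0"
      by (simp add: t_def)
    then have "norm (x + t *\<^sub>R (x - z)) \<le> B"
      by (intro B) (auto simp: ray_def)
    moreover have "norm (t *\<^sub>R (x - z)) = B + norm x + 1"
      using \<open>norm (x - z) > 0\<close> \<open>B \<ge> 0\<close> by (simp add: t_def)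
    moreover have "norm (t *\<^sub>R (x - z)) \<le> norm (x + t *\<^sub>R (x - z)) + norm x"
      by (metis add_diff_cancel_left' norm_triangle_ineq4)
    ultimately show False
      by linarith
  qed
  then show ?thesis
    using sub bounded_subset by blast
qed

text \<open>Convexity of the region is not assumed, so this serves both directions of the passage
  between regions and hulls.\<close>

lemma region_subset_conv:
  assumes "0 < length p"
  shows "region p \<subseteq> conv p"
proof
  fix x assume x: "x \<in> region p"
  show "x \<in> conv p"
  proof (rule ccontr)
    assume "x \<notin> conv p"
    then have "x \<in> affine hull (set p)"
      "bounded (connected_component_set (affine hull (conv p) - \<Union>(sides p)) x)"
      using x sides_subset_conv unfolding region_def Let_def by auto
    then show False
      using unbounded_component_outside_convex[of "conv p" x "\<Union>(sides p)"]
        \<open>x \<notin> conv p\<close> sides_subset_conv assms by auto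
  qed
qed

lemma region_eq_conv:
  assumes "0 < length p" "convex (region p)"
  shows "region p = conv p"
proof -
  have "set p \<subseteq> region p"
    using set_subset_sides unfolding region_def Let_def by blast
  then have "conv p \<subseteq> region p"
    using assms by (intro hull_minimal) auto
  then show ?thesis
    using region_subset_conv[OF assms(1)] by blast
qed

text \<open>The sides form the relative frontier of the hull. A connected set off the chain that
  starts in the relative interior cannot leave the hull: an open set cutting out the relative
  interior and the complement of the hull would separate it. So the component of such a point is
  bounded.\<close>

lemma region_convex_corners:
  assumes p: "convex_corners p"
  shows "region p = conv p"
proof
  let ?K = "conv p" and ?C = "\<Union>(sides p)"
  show "region p \<subseteq> ?K"
    by (rule region_subset_conv[OF convex_cornersD(2)[OF p]])
  show "?K \<subseteq> region p"
  proof
    fix x assume x: "x \<in> ?K"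
    show "x \<in> region p"
    proof (cases "x \<in> ?C")
      case True
      then show ?thesis
        unfolding region_def Let_def by blast
    next
      case False
      let ?E = "affine hull (set p) - ?C"
      have "closed ?K"
        by (simp add: compact_imp_closed finite_imp_compact_convex_hull)
      then have front: "?C = ?K - rel_interior ?K"
        using rel_frontier_conv[OF p] by (simp add: rel_frontier_def)
      have sub: "connected_component_set ?E x \<subseteq> ?K"
      proof (rule ccontr)
        assume ne: "\<not> connected_component_set ?E x \<subseteq> ?K"
        let ?D = "connected_component_set ?E x"
        obtain U where U: "open U" "rel_interior ?K = affine hull ?K \<inter> U"
          using openin_rel_interior[of ?K] unfolding openin_open by blast
        have "?D \<subseteq> ?E"
          by (rule connected_component_subset)
        then have "?D \<subseteq> U \<union> (- ?K)" "U \<inter> (- ?K) \<inter> ?D = {}"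
          using front U(2) rel_interior_subset[of ?K] by auto
        moreover have "x \<in> ?D"
          using False x convex_hull_subset_affine_hull by fastforce
        then have "U \<inter> ?D \<noteq> {}"
          using False x front U(2) by auto
        moreover have "(- ?K) \<inter> ?D \<noteq> {}"
          using ne by blast
        ultimately show False
          using connectedD[OF connected_connected_component[of ?E x] \<open>open U\<close> open_Compl[OF \<open>closed ?K\<close>]]
          by blast
      qed
      have "bounded ?K"
        by (simp add: compact_imp_bounded finite_imp_compact_convex_hull)
      then have "bounded (connected_component_set ?E x)"
        using sub bounded_subset by blast
      moreover have "x \<in> ?E"
        using False x convex_hull_subset_affine_hull by blast
      ultimately show ?thesis
        unfolding region_def Let_def by blast
    qed
  qed
qed

section \<open>Strictly convex position versus strictly convex polygons\<close>

lemma functional_not_both_ends: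
  assumes p: "convex_corners p" and ij: "i mod length p \<noteq> j mod length p"
    and ab: "\<And>x. x \<in> set p \<Longrightarrow> a \<bullet> x = b \<longleftrightarrow> x = corner p i \<or> x = corner p (Suc i)"
  shows "\<not> (a \<bullet> corner p j = b \<and> a \<bullet> corner p (Suc j) = b)"
proof
  note pD = convex_cornersD[OF p]
  assume "a \<bullet> corner p j = b \<and> a \<bullet> corner p (Suc j) = b"
  then have *: "corner p j = corner p i \<or> corner p j = corner p (Suc i)"
    "corner p (Suc j) = corner p i \<or> corner p (Suc j) = corner p (Suc i)"
    using ab corner_in_set[OF pD(2)] by auto
  \<comment> \<open>If both ends of side \<open>j\<close> are on the line of side \<open>i\<close>,
    then \<open>j\<close> must be the successor of \<open>i\<close>, and its far end is the corner
    two after \<open>i\<close>, which is not on that line.\<close>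
  have "corner p j \<noteq> corner p i"
    using ij corner_eq_iff[OF pD(3,2)] by auto
  then have "corner p j = corner p (Suc i)"
    using * by blast
  then have "j mod length p = Suc i mod length p"
    using corner_eq_iff[OF pD(3,2)] by auto
  then have "Suc j mod length p = Suc (Suc i) mod length p"
    by (metis mod_Suc_eq)
  then have "corner p (Suc j) = corner p (Suc (Suc i))"
    using corner_eq_iff[OF pD(3,2)] by auto
  then show False
    using *(2) corner_neq[OF pD(3,1)] by metis
qed

text \<open>On side \<open>j\<close> the functional of side \<open>i\<close> can reach its maximum
  only at an end, because it is not maximal at both ends. So a common point of two sides is an end
  of \<open>j\<close> and, with the roles exchanged, of \<open>i\<close>. The same functional shows
  that the next corner is off the line of a side.\<close>

lemma convex_corners_imp_polygon:
  assumes p: "convex_corners p"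
  shows "polygon p" "strictly_convex p"
proof -
  note pD = convex_cornersD[OF p]
  have sub: "side p i \<inter> side p j \<subseteq> {corner p i, corner p (Suc i)} \<inter> {corner p j, corner p (Suc j)}"
    if ij: "i < length p" "j < length p" "i \<noteq> j" for i j
  proof -
    have key: "x \<in> {corner p j, corner p (Suc j)}" if x: "x \<in> side p i" "x \<in> side p j"
      and ij: "i < length p" "j < length p" "i \<noteq> j" for x i j
    proof -
      obtain a b where ab: "\<And>x. x \<in> conv p \<Longrightarrow> a \<bullet> x \<le> b" "conv p \<inter> {x. a \<bullet> x = b} = side p i"
        "\<And>x. x \<in> set p \<Longrightarrow> a \<bullet> x = b \<longleftrightarrow> x = corner p i \<or> x = corner p (Suc i)"
        by (rule side_exposed[OF p, of i]) (rule that; blast)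
      have "\<not> (a \<bullet> corner p j = b \<and> a \<bullet> corner p (Suc j) = b)"
        by (rule functional_not_both_ends[OF p _ ab(3)]) (use ij in simp_all)
      moreover have le: "a \<bullet> corner p j \<le> b" "a \<bullet> corner p (Suc j) \<le> b"
        using ab(1) corner_in_set[OF pD(2)] by (auto simp: hull_inc)
      moreover obtain u where u: "0 \<le> u" "u \<le> 1" "x = (1 - u) *\<^sub>R corner p j + u *\<^sub>R corner p (Suc j)"
        using x(2) unfolding side_def in_segment by blast
      moreover have "a \<bullet> x = b"
        using x(1) ab(2) by blast
      then have "(1 - u) * (b - a \<bullet> corner p j) + u * (b - a \<bullet> corner p (Suc j)) = 0"
        by (simp add: u(3) inner_add_right algebra_simps)
      then have "(1 - u) * (b - a \<bullet> corner p j) = 0" "u * (b - a \<bullet> corner p (Suc j)) = 0"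
        using u(1,2) le mult_nonneg_nonneg[of "1 - u" "b - a \<bullet> corner p j"]
          mult_nonneg_nonneg[of u "b - a \<bullet> corner p (Suc j)"]
        by linarith+
      ultimately have "u = 0 \<or> u = 1"
        unfolding mult_eq_0_iff by argo
      then show ?thesis
        using u(3) by auto
    qed
    then show ?thesis
      using ij by blast
  qed
  have "side p i \<inter> side p j = {corner p i, corner p (Suc i)} \<inter> {corner p j, corner p (Suc j)}"
    if "i < length p" "j < length p" "i \<noteq> j" for i j
  proof
    show "{corner p i, corner p (Suc i)} \<inter> {corner p j, corner p (Suc j)} \<subseteq> side p i \<inter> side p j"
      using corner_in_side[of p i] corner_in_side[of p j] by auto
  qed (rule sub[OF that])
  then show "polygon p"
    using pD unfolding polygon_def by blast
  have "\<not> collinear {corner p i, corner p (i + 1), corner p (i + 2)}" for i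
  proof -
    obtain a b where ab:
      "\<And>x. x \<in> set p \<Longrightarrow> a \<bullet> x = b \<longleftrightarrow> x = corner p i \<or> x = corner p (Suc i)"
      using convex_corners_functional[OF p, of i] by metis
    have "corner p (i + 2) \<noteq> corner p i" "corner p (i + 2) \<noteq> corner p (Suc i)"
      "corner p i \<noteq> corner p (i + 1)"
      using corner_neq[OF pD(3,1), of i] corner_neq[OF pD(3,1), of "Suc i"] by simp_all
    then show ?thesis
      using ab corner_in_set[OF pD(2)]
      by (intro aff_dim_two_corners(1)[of _ _ _ UNIV a b]) simp_all
  qed
  then show "strictly_convex p"
    unfolding strictly_convex_def region_convex_corners[OF p] by auto
qed

text \<open>A facet of the hull is a union of sides. Two of these could meet only if they were consecutive,
  hence collinear, so by connectedness there is just one.\<close>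

lemma polygon_facet_is_side:
  assumes p: "polygon p" "strictly_convex p" and F: "F facet_of conv p"
  shows "F \<in> sides p"
proof -
  have n: "3 \<le> length p" "0 < length p" and dist: "distinct p" and dim: "aff_dim (set p) = 2"
    and simple: "\<And>i j. i < length p \<Longrightarrow> j < length p \<Longrightarrow> i \<noteq> j \<Longrightarrow>
      side p i \<inter> side p j = {corner p i, corner p (Suc i)} \<inter> {corner p j, corner p (Suc j)}"
    using p(1) unfolding polygon_def by auto
  have region: "region p = conv p"
    using p(2) region_eq_conv[OF n(2)] unfolding strictly_convex_def by blast
  let ?K = "conv p" and ?C = "\<Union>(sides p)"
  have poly: "polyhedron ?K"
    by (simp add: polyhedron_convex_hull)
  have finC: "finite (sides p)" "closed ?C"
    unfolding sides_def by (auto simp: side_def intro!: closed_UN)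
  \<comment> \<open>Near a frontier point \<open>x\<close> off the chain, the plane contains a point
    \<open>y\<close> outside the hull that is joined to \<open>x\<close> without crossing the chain.
    Since \<open>x\<close> is in the region, its component is bounded, so \<open>y\<close> is in the
    region as well, although the region equals the hull.\<close>
  have "rel_frontier ?K \<subseteq> ?C"
  proof
    fix x assume x: "x \<in> rel_frontier ?K"
    then have xK: "x \<in> ?K" "x \<notin> rel_interior ?K"
      using polyhedron_imp_closed[OF poly] by (auto simp: rel_frontier_def)
    show "x \<in> ?C"
    proof (rule ccontr)
      assume "x \<notin> ?C"
      let ?E = "affine hull (set p) - ?C"
      obtain e where "e > 0" and e: "ball x e \<inter> ?C = {}"
        using \<open>x \<notin> ?C\<close> finC(2) by (metis Compl_iff disjoint_eq_subset_Compl open_Compl open_contains_ball)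
      obtain y where y: "y \<in> ball x e" "y \<in> affine hull (set p)" "y \<notin> ?K"
        using xK \<open>e > 0\<close> unfolding rel_interior_ball
        by (metis (mono_tags, lifting) Int_iff affine_hull_convex_hull mem_Collect_eq subsetI)
      have xaff: "x \<in> affine hull (set p)"
        using xK(1) convex_hull_subset_affine_hull by blast
      have "convex (ball x e \<inter> affine hull (set p))"
        by (simp add: affine_imp_convex convex_Int)
      then have conn: "connected_component ?E x y"
        using y e xaff \<open>e > 0\<close> by (intro connected_componentI[of "ball x e \<inter> affine hull (set p)"])
          (auto intro: convex_connected)
      have "x \<in> region p" "y \<notin> region p"
        using region xK y by auto
      then have "bounded (connected_component_set ?E x)"
        using \<open>x \<notin> ?C\<close> unfolding region_def Let_def by blast
      then have "bounded (connected_component_set ?E y)"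
        using connected_component_eq[of y ?E x] conn by simp
      then have "y \<in> region p"
        using conn connected_component_in unfolding region_def Let_def by fastforce
      then show False
        using \<open>y \<notin> region p\<close> by blast
    qed
  qed
  then have FC: "F \<subseteq> ?C"
    using F rel_frontier_of_polyhedron[OF poly] by blast
  have Ff: "F face_of ?K" "F \<noteq> {}" "aff_dim F = 1"
    using F dim by (auto simp: facet_of_def aff_dim_convex_hull)
  then have "convex F" "closed F"
    by (auto intro: face_of_imp_convex face_of_imp_closed poly polyhedron_imp_closed)
  let ?T = "{s \<in> sides p. s \<subseteq> F}"
  \<comment> \<open>By the face property, a point of \<open>F\<close> in the open side would pull
    both ends of the side, hence the whole side, into \<open>F\<close>.\<close>
  have endp: "F \<inter> s \<subseteq> set p" if s: "s \<in> sides p" "\<not> s \<subseteq> F" for s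
  proof
    fix x assume x: "x \<in> F \<inter> s"
    obtain i where i: "s = side p i"
      using s(1) unfolding sides_def by blast
    show "x \<in> set p"
    proof (rule ccontr)
      assume "x \<notin> set p"
      then have "x \<in> open_segment (corner p i) (corner p (Suc i))"
        using x corner_in_set[OF n(2)] unfolding i side_def open_segment_def by force
      then have "corner p i \<in> F" "corner p (Suc i) \<in> F"
        using face_ofD[OF Ff(1)] x hull_inc[OF corner_in_set[OF n(2)]] by blast+
      then show False
        using \<open>convex F\<close> s(2) unfolding i side_def by (simp add: closed_segment_subset)
    qed
  qed
  have FT: "F \<subseteq> \<Union>?T"
  proof
    fix x assume x: "x \<in> F"
    have "F \<noteq> {x}" for x
      using Ff(3) by auto
    then have "x islimpt F"
      using connected_imp_perfect[OF convex_connected[OF \<open>convex F\<close>] x] by blast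
    moreover have "F \<subseteq> \<Union>?T \<union> set p"
      using FC endp by blast
    ultimately have "x islimpt \<Union>?T \<union> set p"
      by (rule islimpt_subset)
    then have "x islimpt \<Union>?T"
      using islimpt_finite[OF finite_set] unfolding islimpt_Un by blast
    moreover have "closed (\<Union>?T)"
      using finC(1) by (auto intro!: closed_Union simp: sides_def side_def)
    ultimately show "x \<in> \<Union>?T"
      using closed_limpt by blast
  qed
  have disj: "s = t" if st: "s \<in> ?T" "t \<in> ?T" "s \<inter> t \<noteq> {}" for s t
  proof (rule ccontr)
    assume "s \<noteq> t"
    obtain i j where i: "i < length p" "s = side p i" and j: "j < length p" "t = side p j"
      using st unfolding sides_def by blast
    then have "i \<noteq> j"
      using \<open>s \<noteq> t\<close> by blast
    have "collinear F"
      using Ff(3) by (simp add: collinear_aff_dim)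
    have no: "corner p k' \<noteq> corner p (Suc k)"
      if "side p k \<subseteq> F" "side p k' \<subseteq> F" "k < length p" for k k'
    proof
      assume "corner p k' = corner p (Suc k)"
      then have "k' mod length p = Suc k mod length p"
        using corner_eq_iff[OF dist n(2)] by blast
      then have "side p (Suc k) \<subseteq> F"
        using that by (metis side_mod)
      then have "{corner p k, corner p (k + 1), corner p (k + 2)} \<subseteq> F"
        using that(1) corner_in_side[of p k] corner_in_side[of p "Suc k"] by auto
      then show False
        using p(2) that(3) collinear_subset[OF \<open>collinear F\<close>] unfolding strictly_convex_def by blast
    qed
    have "corner p i \<noteq> corner p j" "corner p (Suc i) \<noteq> corner p (Suc j)"
      using \<open>i \<noteq> j\<close> i j corner_eq_iff[OF dist n(2)]
      by (auto simp: mod_Suc split: if_splits)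
    moreover have "corner p i \<noteq> corner p (Suc j)" "corner p j \<noteq> corner p (Suc i)"
      using no i j st by auto
    ultimately have "s \<inter> t = {}"
      using simple[OF i(1) j(1) \<open>i \<noteq> j\<close>] i(2) j(2) by auto
    then show False
      using st(3) by blast
  qed
  obtain s where s: "s \<in> ?T"
    using FT Ff(2) by blast
  have fin: "finite ?T" and cl: "\<And>s. s \<in> ?T \<Longrightarrow> closed s" and "s \<noteq> {}"
    using finC(1) s by (auto simp: sides_def side_def)
  have "closed s" "closed (\<Union>(?T - {s}))"
    using fin cl s by (auto intro!: closed_Union)
  moreover have "s \<inter> \<Union>(?T - {s}) \<inter> F = {}" "F \<subseteq> s \<union> \<Union>(?T - {s})" "s \<inter> F \<noteq> {}"
  proof -
    show "s \<inter> \<Union>(?T - {s}) \<inter> F = {}"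
      using disj[OF s] by blast
    show "F \<subseteq> s \<union> \<Union>(?T - {s})"
      using FT by blast
    show "s \<inter> F \<noteq> {}"
      using s \<open>s \<noteq> {}\<close> by blast
  qed
  ultimately have "\<Union>(?T - {s}) \<inter> F = {}"
    using connected_closedD[OF convex_connected[OF \<open>convex F\<close>], of s "\<Union>(?T - {s})"] by blast
  then have "F = s"
    using \<open>F \<subseteq> s \<union> \<Union>(?T - {s})\<close> s by blast
  then show ?thesis
    using s by blast
qed

text \<open>All facets are sides; conversely, the property of being a facet travels around the
  polygon. The far end of a facet is a vertex of the hull, thus the intersection of the facets
  through it, so a second facet starts there. By simplicity of the chain this facet can only be the
  next side. The functional of side \<open>i\<close> is then a supporting functional of a
  facet.\<close>

lemma polygon_imp_convex_corners:
  assumes p: "polygon p" "strictly_convex p"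
  shows "convex_corners p"
proof -
  have n: "3 \<le> length p" "0 < length p" and dist: "distinct p" and dim: "aff_dim (set p) = 2"
    and simple: "\<And>i j. i < length p \<Longrightarrow> j < length p \<Longrightarrow> i \<noteq> j \<Longrightarrow>
      side p i \<inter> side p j = {corner p i, corner p (Suc i)} \<inter> {corner p j, corner p (Suc j)}"
    using p(1) unfolding polygon_def by auto
  let ?K = "conv p"
  have poly: "polyhedron ?K"
    by (simp add: polyhedron_convex_hull)
  have corner_side: "corner p k = corner p i \<or> corner p k = corner p (Suc i)"
    if "corner p k \<in> side p i" for i k
  proof -
    have lt: "k mod length p < length p" "i mod length p < length p"
      using n by auto
    show ?thesis
    proof (cases "k mod length p = i mod length p")
      case True
      then show ?thesis by (metis corner_mod)
    next
      case False
      have "corner p k \<in> side p (k mod length p) \<inter> side p (i mod length p)"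
        using that corner_in_side[of p k] by simp
      then have "corner p k \<in> {corner p (i mod length p), corner p (Suc (i mod length p))}"
        using simple[OF lt False] by blast
      then show ?thesis
        by (metis corner_mod empty_iff insert_iff mod_Suc_eq)
    qed
  qed
  have step: "side p (Suc i) facet_of ?K" if i: "side p i facet_of ?K" for i
  proof -
    let ?v = "corner p (Suc i)"
    have "?v extreme_point_of side p i"
      unfolding side_def by (simp add: extreme_point_of_segment)
    then have v: "{?v} face_of ?K"
      using extreme_point_of_face[OF facet_of_imp_face_of[OF i]] face_of_singleton by blast
    have "?K \<noteq> {?v}"
      using dim by (metis aff_dim_convex_hull aff_dim_sing zero_neq_numeral)
    then have Int: "{?v} = \<Inter>{F. F facet_of ?K \<and> {?v} \<subseteq> F}"
      using face_of_polyhedron[OF poly v] by blast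
    have "corner p i \<noteq> ?v"
      using corner_neq[OF dist n(1)] by blast
    then obtain F where F: "F facet_of ?K" "?v \<in> F" "F \<noteq> side p i"
      using Int corner_in_side(1)[of p i] by blast
    obtain j where j: "F = side p j"
      using polygon_facet_is_side[OF p F(1)] unfolding sides_def by blast
    then have "?v = corner p j \<or> ?v = corner p (Suc j)"
      using F(2) corner_side by blast
    then have "Suc i mod length p = j mod length p \<or> Suc i mod length p = Suc j mod length p"
      using corner_eq_iff[OF dist n(2)] by blast
    moreover have "i mod length p \<noteq> j mod length p"
      using F(3) j by (metis side_mod)
    then have "Suc i mod length p \<noteq> Suc j mod length p"
      by (auto simp: mod_Suc split: if_splits)
    ultimately show ?thesis
      using F(1) j by (metis side_mod)
  qed
  obtain F where "F facet_of ?K"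
    using polytope_facet_exists[OF polytope_convex_hull[OF finite_set]] dim
    by (metis aff_dim_convex_hull zero_less_numeral)
  then obtain i where i: "side p i facet_of ?K"
    using polygon_facet_is_side[OF p] unfolding sides_def by blast
  have from_i: "side p (i + m) facet_of ?K" for m
    by (induction m) (use i step in auto)
  have facet: "side p j facet_of ?K" for j
  proof -
    \<comment> \<open>Full turns are added to \<open>j\<close> so that it can be reached from
      \<open>i\<close> by forward steps only.\<close>
    have "i \<le> length p * i"
      using mult_le_mono1[of 1 "length p" i] n(2) by linarith
    then have "i \<le> j + length p * i"
      by linarith
    then have "i + (j + length p * i - i) = j + length p * i"
      by (rule le_add_diff_inverse)
    then show ?thesis
      using from_i[of "j + length p * i - i"] by simp
  qed
  have "\<exists>a b. \<forall>x\<in>set p.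
        a \<bullet> x \<le> b \<and> (a \<bullet> x = b \<longleftrightarrow> x = corner p i \<or> x = corner p (Suc i))" for i
  proof -
    obtain a b where ab: "?K \<subseteq> {x. a \<bullet> x \<le> b}" "side p i = ?K \<inter> {x. a \<bullet> x = b}"
      using facet_of_polyhedron[OF poly facet] by metis
    have "a \<bullet> x \<le> b \<and> (a \<bullet> x = b \<longleftrightarrow> x = corner p i \<or> x = corner p (Suc i))" if x: "x \<in> set p" for x
    proof -
      have "x \<in> ?K"
        using x by (simp add: hull_inc)
      moreover have "x \<in> side p i \<longleftrightarrow> x = corner p i \<or> x = corner p (Suc i)"
        using in_set_corner[OF x] corner_side corner_in_side by metis
      ultimately show ?thesis
        using ab by blast
    qed
    then show ?thesis by blast
  qed
  then show ?thesis
    using n dist dim unfolding convex_corners_def by blast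
qed

section \<open>Cutting off a side\<close>

lemma corner_rotate:
  assumes "0 < length p"
  shows "corner (rotate m p) i = corner p (i + m)"
  using assms by (simp add: corner_def nth_rotate mod_add_left_eq add.commute mod_add_right_eq)

lemma sides_eq_range: "0 < length p \<Longrightarrow> sides p = range (side p)"
  using side_in_sides unfolding sides_def by blast

lemma sides_rotate:
  assumes "0 < length p"
  shows "side (rotate m p) i = side p (i + m)" "sides (rotate m p) = sides p"
proof -
  show *: "side (rotate m p) i = side p (i + m)" for i
    by (simp add: side_def corner_rotate[OF assms])
  have "side p i \<in> range (side (rotate m p))" for i
  proof -
    have "m \<le> length p * m"
      using mult_le_mono1[of 1 "length p" m] assms by linarith
    then have "i + length p * m - m + m = i + length p * m"
      by linarith
    then have "side (rotate m p) (i + length p * m - m) = side p i"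
      by (metis * side_add_mult_length)
    then show ?thesis
      by (metis rangeI)
  qed
  then have "range (side (rotate m p)) = range (side p)"
    using * by auto
  then show "sides (rotate m p) = sides p"
    using assms by (simp add: sides_eq_range)
qed

lemma convex_corners_rotate:
  assumes "convex_corners p"
  shows "convex_corners (rotate m p)"
  unfolding convex_corners_def
proof (intro conjI allI)
  show "\<exists>a b. \<forall>x\<in>set (rotate m p). a \<bullet> x \<le> b \<and>
    (a \<bullet> x = b \<longleftrightarrow> x = corner (rotate m p) i \<or> x = corner (rotate m p) (Suc i))" for i
    using assms unfolding convex_corners_def
    by (metis (no_types, lifting) add_Suc assms convex_cornersD(2) corner_rotate set_rotate)
qed (use convex_cornersD[OF assms] in auto)

lemma functional_convex_combination_less:
  fixes a v w :: "'a::real_inner"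
  assumes "0 < t" "t < 1" "a \<bullet> v \<le> b" "a \<bullet> w \<le> b" "\<not> (a \<bullet> v = b \<and> a \<bullet> w = b)"
  shows "a \<bullet> ((1 - t) *\<^sub>R v + t *\<^sub>R w) < b"
proof -
  have eq: "a \<bullet> ((1 - t) *\<^sub>R v + t *\<^sub>R w) = b - ((1 - t) * (b - a \<bullet> v) + t * (b - a \<bullet> w))"
    by (simp add: inner_add_right algebra_simps)
  have "(1 - t) * (b - a \<bullet> v) \<ge> 0" "t * (b - a \<bullet> w) \<ge> 0"
    using assms by auto
  moreover have "a \<bullet> v < b \<or> a \<bullet> w < b"
    using assms by linarith
  then have "(1 - t) * (b - a \<bullet> v) > 0 \<or> t * (b - a \<bullet> w) > 0"
    using assms by auto
  ultimately show "a \<bullet> ((1 - t) *\<^sub>R v + t *\<^sub>R w) < b"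
    unfolding eq by linarith
qed

lemma functional_convex_combination_eq:
  fixes a v w :: "'a::real_inner"
  shows "a \<bullet> v = b \<Longrightarrow> a \<bullet> w = b \<Longrightarrow> a \<bullet> ((1 - t) *\<^sub>R v + t *\<^sub>R w) = b"
  by (simp add: inner_add_right algebra_simps)

lemma convex_corners_functional_nth:
  assumes p: "convex_corners p" and i: "i < length p"
  obtains a b where "\<forall>k<length p. a \<bullet> p ! k \<le> b"
    "\<forall>k<length p. a \<bullet> p ! k = b \<longleftrightarrow> k = i \<or> k = Suc i mod length p"
proof -
  note pD = convex_cornersD[OF p]
  obtain a b where ab: "\<And>x. x \<in> set p \<Longrightarrow> a \<bullet> x \<le> b"
    "\<And>x. x \<in> set p \<Longrightarrow> a \<bullet> x = b \<longleftrightarrow> x = corner p i \<or> x = corner p (Suc i)"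
    by (rule convex_corners_functional[OF p]) (rule that; blast)
  have "a \<bullet> p ! k = b \<longleftrightarrow> k = i \<or> k = Suc i mod length p" if k: "k < length p" for k
  proof -
    have "a \<bullet> corner p k = b \<longleftrightarrow> corner p k = corner p i \<or> corner p k = corner p (Suc i)"
      by (rule ab(2)[OF corner_in_set[OF pD(2)]])
    then show ?thesis
      unfolding corner_eq_iff[OF pD(3,2)] using k i by (simp add: corner_nth)
  qed
  then show thesis
    using that ab(1) nth_mem by metis
qed

text \<open>The new ends of the cut lie on the sides next to side 0, so the functionals of
  \<open>p\<close> also describe both pieces. The last conclusion is about the sides other than side
  0 and its neighbours, the only ones that may be shared with further polygons when the lemma is
  applied.\<close>

lemma cut_first_side:
  assumes p: "convex_corners p"
  obtains p' R where "convex_corners p'" "convex_corners R"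
    "conv p' \<subseteq> conv p" "conv R \<subseteq> conv p" "side p 0 \<in> sides R"
    "conv p' \<inter> conv R \<in> sides p' \<inter> sides R" "conv p' \<inter> side p 0 = {}"
    "\<forall>t\<in>sides p. t \<inter> side p 0 = {} \<longrightarrow> t \<in> sides p' \<and> conv R \<inter> t = {}"
proof -
  note pD = convex_cornersD[OF p]
  define n where "n = length p"
  have n: "3 \<le> n"
    using pD(1) n_def by simp
  obtain x y r where pr: "p = x # y # r" "r \<noteq> []"
    using pD(1) by (cases p; cases "tl p"; cases "tl (tl p)") auto
  \<comment> \<open>The other neighbours of \<open>x\<close> and \<open>y\<close>; in a triangle
    they are the same corner.\<close>
  define u z where "u = p ! (n - 1)" and "z = p ! 2"
  have nth: "p ! 0 = x" "p ! 1 = y" and lr: "length r = n - 2"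
    using pr n_def by auto
  have uz: "u \<in> set r" "z \<in> set r"
    using n pr lr unfolding u_def z_def by (auto simp: nth_Cons')
  obtain a0 b0 where ab0: "\<forall>k<n. a0 \<bullet> p ! k \<le> b0" "\<forall>k<n. a0 \<bullet> p ! k = b0 \<longleftrightarrow> k = 0 \<or> k = Suc 0 mod n"
    using convex_corners_functional_nth[OF p pD(2)] unfolding n_def by blast
  have xy0: "a0 \<bullet> x = b0" "a0 \<bullet> y = b0"
    using ab0(2) nth n by auto
  have r0: "a0 \<bullet> v < b0" if v: "v \<in> set r" for v
  proof -
    obtain k where k: "k < length r" "v = r ! k"
      using v by (metis in_set_conv_nth)
    then have K: "Suc (Suc k) < n" "v = p ! Suc (Suc k)"
      using pr lr n by auto
    have "Suc 0 mod n = 1"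
      using n by auto
    then have "a0 \<bullet> p ! Suc (Suc k) \<noteq> b0"
      using ab0(2) K(1) by simp
    then show ?thesis
      using ab0(1) K by (simp add: less_le)
  qed
  \<comment> \<open>Half the smallest depth of a corner below side 0, so that every other corner
    stays strictly beyond the cut.\<close>
  define d where "d = (MIN v\<in>set r. b0 - a0 \<bullet> v) / 2"
  have d0: "d > 0"
    unfolding d_def using pr(2) r0 by (intro divide_pos_pos) (auto simp: Min_gr_iff)
  have d: "a0 \<bullet> v < b0 - d" if "v \<in> set r" for v
  proof -
    have "(MIN v\<in>set r. b0 - a0 \<bullet> v) \<le> b0 - a0 \<bullet> v"
      using that by (intro Min_le) auto
    then show ?thesis
      using d0 unfolding d_def by linarith
  qed
  \<comment> \<open>The ratios that bring \<open>x'\<close> and \<open>y'\<close> to the same depth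
    \<open>d\<close>, which makes the cut parallel to side 0.\<close>
  define cu cz where "cu = d / (b0 - a0 \<bullet> u)" and "cz = d / (b0 - a0 \<bullet> z)"
  have c: "0 < cu" "cu < 1" "0 < cz" "cz < 1"
    using d0 d[OF uz(1)] d[OF uz(2)] unfolding cu_def cz_def by auto
  define x' y' where "x' = (1 - cu) *\<^sub>R x + cu *\<^sub>R u" and "y' = (1 - cz) *\<^sub>R y + cz *\<^sub>R z"
  have "a0 \<bullet> x' = b0 - cu * (b0 - a0 \<bullet> u)" "a0 \<bullet> y' = b0 - cz * (b0 - a0 \<bullet> z)"
    unfolding x'_def y'_def using xy0 by (simp_all add: inner_add_right algebra_simps)
  then have xy0': "a0 \<bullet> x' = b0 - d" "a0 \<bullet> y' = b0 - d"
    using r0[OF uz(1)] r0[OF uz(2)] unfolding cu_def cz_def by simp_all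
  define p' R where "p' = x' # y' # r" and "R = [x, y, y', x']"
  have len: "length p' = n"
    unfolding p'_def using pr n_def by simp
  have in_p: "x \<in> conv p" "y \<in> conv p" "u \<in> conv p" "z \<in> conv p"
    using uz pr(1) by (auto simp: hull_inc)
  have "x' \<in> conv p" "y' \<in> conv p"
    unfolding x'_def y'_def using c in_p by (auto intro!: convexD[OF convex_convex_hull])
  moreover have "set r \<subseteq> conv p"
    using hull_subset[of "set p" convex] unfolding pr(1) by auto
  ultimately have "set p' \<subseteq> conv p" "set R \<subseteq> conv p"
    using in_p unfolding p'_def R_def set_simps by blast+
  then have sub: "conv p' \<subseteq> conv p" "conv R \<subseteq> conv p"
    by (simp_all add: subset_hull)
  then have dim: "aff_dim (set p') \<le> 2" "aff_dim (set R) \<le> 2"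
    using aff_dim_subset[OF sub(1)] aff_dim_subset[OF sub(2)] pD(4) by (simp_all add: aff_dim_convex_hull)
  have nth': "p' ! 0 = x'" "p' ! 1 = y'" "\<And>k. 2 \<le> k \<Longrightarrow> p' ! k = p ! k"
    unfolding p'_def pr(1) by (auto simp: nth_Cons')
  \<comment> \<open>The cut leaves the supporting lines of all sides but the first one unchanged.\<close>
  have lines: "\<exists>a b. (\<forall>k<n. a \<bullet> p ! k \<le> b) \<and> (\<forall>k<n. a \<bullet> p ! k = b \<longleftrightarrow> k = i \<or> k = Suc i mod n) \<and>
      (i \<noteq> n - 1 \<longrightarrow> a \<bullet> x < b \<and> a \<bullet> x' < b) \<and> (i = n - 1 \<longrightarrow> a \<bullet> x = b \<and> a \<bullet> x' = b) \<and>
      (i \<noteq> 1 \<longrightarrow> a \<bullet> y < b \<and> a \<bullet> y' < b) \<and> (i = 1 \<longrightarrow> a \<bullet> y = b \<and> a \<bullet> y' = b)"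
    if i: "0 < i" "i < n" for i
  proof -
    obtain a b where ab: "\<forall>k<n. a \<bullet> p ! k \<le> b" "\<forall>k<n. a \<bullet> p ! k = b \<longleftrightarrow> k = i \<or> k = Suc i mod n"
      using convex_corners_functional_nth[OF p] i(2) unfolding n_def by blast
    have lt: "0 < n" "1 < n" "2 < n" "n - 1 < n"
      using n by auto
    have le: "a \<bullet> x \<le> b" "a \<bullet> y \<le> b" "a \<bullet> u \<le> b" "a \<bullet> z \<le> b"
      using ab(1) lt nth unfolding u_def z_def by metis+
    have Suci: "Suc i mod n = (if i = n - 1 then 0 else Suc i)"
      using i n by auto
    have "a \<bullet> x = b \<longleftrightarrow> i = n - 1" "a \<bullet> y = b \<longleftrightarrow> i = 1" "a \<bullet> u = b \<longleftrightarrow> i = n - 1 \<or> i = n - 2"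
      "a \<bullet> z = b \<longleftrightarrow> i = 2 \<or> i = 1"
      using ab(2) lt nth i n unfolding u_def z_def Suci by (auto simp flip: nth)
    then have "i \<noteq> n - 1 \<longrightarrow> a \<bullet> x < b \<and> a \<bullet> x' < b" "i = n - 1 \<longrightarrow> a \<bullet> x = b \<and> a \<bullet> x' = b"
      "i \<noteq> 1 \<longrightarrow> a \<bullet> y < b \<and> a \<bullet> y' < b" "i = 1 \<longrightarrow> a \<bullet> y = b \<and> a \<bullet> y' = b"
      using functional_convex_combination_less[OF c(1,2) le(1,3), folded x'_def]
        functional_convex_combination_eq[of a x b u cu, folded x'_def]
        functional_convex_combination_less[OF c(3,4) le(2,4), folded y'_def]
        functional_convex_combination_eq[of a y b z cz, folded y'_def] le(1,2)
      by (simp_all add: less_le)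
    then show ?thesis
      using ab by blast
  qed
  have p': "convex_corners p'"
  proof (rule convex_cornersI)
    fix i assume "i < length p'"
    then have i: "i < n"
      using len by simp
    show "\<exists>a b. a \<bullet> p' ! i = b \<and> a \<bullet> corner p' (Suc i) = b \<and>
      (\<forall>k<length p'. k \<noteq> i \<longrightarrow> k \<noteq> Suc i mod length p' \<longrightarrow> a \<bullet> p' ! k < b)"
    proof (cases "i = 0")
      case True
      have "a0 \<bullet> p' ! k < b0 - d" if "k < n" "k \<noteq> 0" "k \<noteq> 1" for k
        using that lr n d unfolding p'_def by (auto simp: nth_Cons')
      then show ?thesis
        using True n len xy0' nth' by (intro exI[of _ a0] exI[of _ "b0 - d"]) (auto simp: corner_def)
    next
      case False
      then obtain a b where ab: "\<forall>k<n. a \<bullet> p ! k \<le> b" "\<forall>k<n. a \<bullet> p ! k = b \<longleftrightarrow> k = i \<or> k = Suc i mod n"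
        "i \<noteq> n - 1 \<longrightarrow> a \<bullet> x' < b" "i = n - 1 \<longrightarrow> a \<bullet> x' = b"
        "i \<noteq> 1 \<longrightarrow> a \<bullet> y' < b" "i = 1 \<longrightarrow> a \<bullet> y' = b"
        using lines[of i] i by auto
      have Suci: "Suc i mod n = (if i = n - 1 then 0 else Suc i)"
        using i n by auto
      have "a \<bullet> p' ! k \<le> b \<and> (a \<bullet> p' ! k = b \<longleftrightarrow> k = i \<or> k = Suc i mod n)" if k: "k < n" for k
      proof -
        consider "k = 0" | "k = 1" | "2 \<le> k"
          by linarith
        then show ?thesis
        proof cases
          case 1
          then show ?thesis
            using ab(3,4) False nth'(1) unfolding Suci by (cases "i = n - 1") auto
        next
          case 2
          then show ?thesis
            using ab(5,6) False nth'(2) unfolding Suci by (cases "i = 1") auto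
        next
          case 3
          then show ?thesis
            using ab(1,2) k nth'(3) by auto
        qed
      qed
      moreover have "Suc i mod n < n"
        using n by simp
      ultimately show ?thesis
        using i unfolding corner_def len
        by (intro exI[of _ a] exI[of _ b]) (simp add: less_le)
    qed
  qed (use n len dim in auto)
  have R: "convex_corners R"
  proof (rule convex_cornersI)
    have ns: "0 < (1::nat)" "1 < n" "1 \<noteq> n - 1" "0 < n - 1" "n - 1 < n" "n - 1 \<noteq> 1"
      using n by auto
    \<comment> \<open>Two sides of \<open>R\<close> lie on sides 1 and \<open>n - 1\<close> of
      \<open>p\<close> and inherit their functionals. The parallel pair uses \<open>a0\<close>,
      negated for the cut because \<open>R\<close> lies on its other side.\<close>
    obtain a1 b1 where 1: "a1 \<bullet> x < b1" "a1 \<bullet> y = b1" "a1 \<bullet> x' < b1" "a1 \<bullet> y' = b1"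
      using lines[OF ns(1,2)] ns(3) by blast
    obtain a2 b2 where 2: "a2 \<bullet> x = b2" "a2 \<bullet> y < b2" "a2 \<bullet> x' = b2" "a2 \<bullet> y' < b2"
      using lines[OF ns(4,5)] ns(6) by blast
    have len4: "length R = 4"
      by (simp add: R_def)
    have R_nth: "R ! 0 = x" "R ! 1 = y" "R ! 2 = y'" "R ! 3 = x'"
      by (simp_all add: R_def)
    have mods: "Suc 0 mod 4 = (1::nat)" "Suc 1 mod 4 = (2::nat)" "Suc 2 mod 4 = (3::nat)" "Suc 3 mod 4 = (0::nat)"
      by simp_all
    have all4: "(\<forall>k<4. P k) \<longleftrightarrow> P 0 \<and> P 1 \<and> P 2 \<and> P 3" for P :: "nat \<Rightarrow> bool"
      by (auto simp: less_Suc_eq numeral_eq_Suc)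
    fix i assume "i < length R"
    then have "i < 4"
      by (simp add: len4)
    then consider "i = 0" | "i = 1" | "i = 2" | "i = 3"
      by linarith
    then show "\<exists>a b. a \<bullet> R ! i = b \<and> a \<bullet> corner R (Suc i) = b \<and>
      (\<forall>k<length R. k \<noteq> i \<longrightarrow> k \<noteq> Suc i mod length R \<longrightarrow> a \<bullet> R ! k < b)"
    proof cases
      case i: 1
      then show ?thesis
        using xy0 xy0' d0 unfolding i corner_def len4 all4 mods R_nth
        by (intro exI[of _ a0] exI[of _ b0]) simp
    next
      case i: 2
      then show ?thesis
        using 1 unfolding i corner_def len4 all4 mods R_nth
        by (intro exI[of _ a1] exI[of _ b1]) simp
    next
      case i: 3
      then show ?thesis
        using xy0 xy0' d0 unfolding i corner_def len4 all4 mods R_nth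
        by (intro exI[of _ "- a0"] exI[of _ "- (b0 - d)"]) simp
    next
      case i: 4
      then show ?thesis
        using 2 unfolding i corner_def len4 all4 mods R_nth
        by (intro exI[of _ a2] exI[of _ b2]) simp
    qed
  qed (use dim in \<open>auto simp: R_def\<close>)
  have s0: "side p 0 = closed_segment x y"
    unfolding side_def corner_def pr(1) using pr(2) by simp
  have s0': "side p' 0 = closed_segment x' y'"
    unfolding side_def corner_def p'_def using pr(2) by simp
  have sR: "side R 0 = closed_segment x y" "side R 2 = closed_segment y' x'"
    unfolding side_def corner_def R_def by simp_all
  \<comment> \<open>The cut line separates the pieces, so they meet only at level
    \<open>b0 - d\<close>, where \<open>x'\<close> and \<open>y'\<close> are the only corners of
    \<open>p'\<close>.\<close>
  have le': "a0 \<bullet> v \<le> b0 - d" if "v \<in> set p'" for v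
    using that xy0' d unfolding p'_def by (auto simp: less_imp_le)
  then have le: "conv p' \<subseteq> {v. a0 \<bullet> v \<le> b0 - d}"
    by (intro hull_minimal) (auto simp: convex_halfspace_le)
  have ge: "conv R \<subseteq> {v. a0 \<bullet> v \<ge> b0 - d}"
    using xy0' xy0 d0 unfolding R_def
    by (intro hull_minimal) (auto simp: convex_halfspace_ge)
  show thesis
  proof
    show "side p 0 \<in> sides R"
      using side_in_sides[of R 0] sR(1) s0 by (simp add: R_def)
    have "conv p' \<inter> {v. a0 \<bullet> v = b0 - d} = convex hull {v \<in> set p'. a0 \<bullet> v = b0 - d}"
      using le' by (intro convex_hull_Int_supporting_hyperplane(2)) auto
    moreover have "{v \<in> set p'. a0 \<bullet> v = b0 - d} = {x', y'}"
      using xy0' d unfolding p'_def by fastforce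
    ultimately have "conv p' \<inter> {v. a0 \<bullet> v = b0 - d} = closed_segment x' y'"
      unfolding segment_convex_hull by simp
    moreover have "closed_segment x' y' \<subseteq> conv p'" "closed_segment x' y' \<subseteq> conv R"
      by (intro closed_segment_subset_convex_hull hull_inc; simp add: p'_def R_def)+
    ultimately have "conv p' \<inter> conv R = closed_segment x' y'"
      using le ge by fastforce
    moreover have "closed_segment x' y' \<in> sides p'" "closed_segment x' y' \<in> sides R"
      using side_in_sides[of p' 0] side_in_sides[of R 2] s0' sR(2)
      unfolding closed_segment_commute[of y' x'] by (simp_all add: p'_def R_def)
    ultimately show "conv p' \<inter> conv R \<in> sides p' \<inter> sides R"
      by simp
    have "closed_segment x y \<subseteq> {v. a0 \<bullet> v = b0}"
      using xy0 by (intro closed_segment_subset) (auto simp: convex_hyperplane)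
    then show "conv p' \<inter> side p 0 = {}"
      using le d0 unfolding s0 by fastforce
  next
    have "t \<in> sides p' \<and> conv R \<inter> t = {}" if t: "t \<in> sides p" "t \<inter> side p 0 = {}" for t
    proof -
      obtain i where i: "i < n" "t = side p i"
        using t(1) unfolding sides_def n_def by blast
      have t': "t = closed_segment (p ! i) (p ! (Suc i mod n))"
        using i unfolding side_def corner_def n_def by simp
      \<comment> \<open>A side that misses side 0 has index neither 0 nor 1 nor
        \<open>n - 1\<close>. Its ends are therefore kept by the cut, and its functional is strict
        at all four corners of \<open>R\<close>.\<close>
      then have "p ! i \<noteq> x" "p ! i \<noteq> y" "p ! (Suc i mod n) \<noteq> x"
        using t(2) unfolding s0 by auto
      then have "i \<noteq> 0" "i \<noteq> 1" "Suc i mod n \<noteq> 0"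
        using nth by metis+
      then have ii: "2 \<le> i" "Suc i < n" "i \<noteq> n - 1"
        using i n by (auto simp: mod_Suc split: if_splits)
      then have "side p' i = t"
        using len nth'(3) unfolding t' side_def corner_def by simp
      then have "t \<in> sides p'"
        using side_in_sides[of p' i] len n by auto
      have "0 < i" "i \<noteq> 1"
        using ii by auto
      then obtain a b where ab: "\<forall>k<n. a \<bullet> p ! k = b \<longleftrightarrow> k = i \<or> k = Suc i mod n"
          "a \<bullet> x < b" "a \<bullet> x' < b" "a \<bullet> y < b" "a \<bullet> y' < b"
        using lines[of i] i(1) ii(3) by blast
      then have "conv R \<subseteq> {v. a \<bullet> v < b}"
        unfolding R_def by (intro hull_minimal) (auto simp: convex_halfspace_lt)
      moreover have "t \<subseteq> {v. a \<bullet> v = b}"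
        unfolding t' using ab(1) i ii by (intro closed_segment_subset) (auto simp: convex_hyperplane)
      ultimately have "conv R \<inter> t = {}"
        by fastforce
      then show ?thesis
        using \<open>t \<in> sides p'\<close> by blast
    qed
    then show "\<forall>t\<in>sides p. t \<inter> side p 0 = {} \<longrightarrow> t \<in> sides p' \<and> conv R \<inter> t = {}"
      by blast
  qed (use p' R sub in auto)
qed

text \<open>Rotating the list makes \<open>s\<close> the first side and changes neither the hull nor
  the set of sides.\<close>

lemma cut_side:
  assumes p: "convex_corners p" and s: "s \<in> sides p"
  obtains p' R where "convex_corners p'" "convex_corners R"
    "conv p' \<subseteq> conv p" "conv R \<subseteq> conv p" "s \<in> sides R"
    "conv p' \<inter> conv R \<in> sides p' \<inter> sides R" "conv p' \<inter> s = {}"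
    "\<forall>t\<in>sides p. t \<inter> s = {} \<longrightarrow> t \<in> sides p' \<and> conv R \<inter> t = {}"
proof -
  obtain i where i: "s = side p i"
    using s unfolding sides_def by blast
  let ?q = "rotate i p"
  have q: "convex_corners ?q" "conv ?q = conv p" "side ?q 0 = s" "sides ?q = sides p"
    using convex_corners_rotate[OF p] sides_rotate[OF convex_cornersD(2)[OF p]] i by auto
  show thesis
    by (rule cut_first_side[OF q(1), unfolded q(2-4)]) (rule that; assumption)
qed

section \<open>Truncating all corners\<close>

text \<open>Scaled sum of the functionals of the two sides at a corner: it cuts off this corner parallel to
  the diagonal of its two neighbours.\<close>

lemma corner_functional:
  assumes p: "convex_corners p"
  obtains a b where "a \<bullet> corner p (Suc i) = b" "a \<bullet> corner p i = b - 1"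
    "a \<bullet> corner p (Suc (Suc i)) = b - 1" "\<forall>x\<in>set p. x \<noteq> corner p (Suc i) \<longrightarrow> a \<bullet> x < b"
proof -
  note pD = convex_cornersD[OF p]
  define u v w where "u = corner p i" and "v = corner p (Suc i)" and "w = corner p (Suc (Suc i))"
  have uvw: "u \<noteq> v" "u \<noteq> w" "v \<noteq> w" "u \<in> set p" "v \<in> set p" "w \<in> set p"
    using corner_neq[OF pD(3,1)] corner_in_set[OF pD(2)] unfolding u_def v_def w_def by auto
  obtain a1 b1 where 1: "\<And>x. x \<in> set p \<Longrightarrow> a1 \<bullet> x \<le> b1"
    "\<And>x. x \<in> set p \<Longrightarrow> a1 \<bullet> x = b1 \<longleftrightarrow> x = u \<or> x = v"
    by (rule convex_corners_functional[OF p, of i, folded u_def v_def]) (rule that; blast)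
  obtain a2 b2 where 2: "\<And>x. x \<in> set p \<Longrightarrow> a2 \<bullet> x \<le> b2"
    "\<And>x. x \<in> set p \<Longrightarrow> a2 \<bullet> x = b2 \<longleftrightarrow> x = v \<or> x = w"
    by (rule convex_corners_functional[OF p, of "Suc i", folded w_def v_def]) (rule that; blast)
  define g where "g = b1 - a1 \<bullet> w"
  define h where "h = b2 - a2 \<bullet> u"
  have on: "a1 \<bullet> u = b1" "a1 \<bullet> v = b1" "a2 \<bullet> v = b2" "a2 \<bullet> w = b2"
    using 1(2) 2(2) uvw by blast+
  have "a1 \<bullet> w \<noteq> b1" "a2 \<bullet> u \<noteq> b2"
    using 1(2)[of w] 2(2)[of u] uvw by blast+
  then have gh: "g > 0" "h > 0"
    using 1(1)[of w] 2(1)[of u] uvw unfolding g_def h_def by auto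
  \<comment> \<open>The weights normalise both neighbours to depth exactly 1. The new corners at
    ratio \<open>e\<close> on the two sides then have the same depth \<open>e\<close>, whatever the
    lengths of the sides.\<close>
  define a where "a = (1 / g) *\<^sub>R a1 + (1 / h) *\<^sub>R a2"
  define b where "b = b1 / g + b2 / h"
  have ax: "a \<bullet> x = b - ((b1 - a1 \<bullet> x) / g + (b2 - a2 \<bullet> x) / h)" for x
    unfolding a_def b_def by (simp add: inner_add_left diff_divide_distrib)
  show thesis
  proof (rule that[of a b], fold u_def v_def w_def)
    show "a \<bullet> v = b" "a \<bullet> u = b - 1" "a \<bullet> w = b - 1"
      unfolding ax on using gh by (simp_all add: g_def h_def)
    show "\<forall>x\<in>set p. x \<noteq> v \<longrightarrow> a \<bullet> x < b"
    proof (intro ballI impI)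
      fix x assume x: "x \<in> set p" "x \<noteq> v"
      \<comment> \<open>The only corner on both sides at \<open>v\<close> is \<open>v\<close>
        itself.\<close>
      then have "a1 \<bullet> x < b1 \<or> a2 \<bullet> x < b2"
        using 1(1)[OF x(1)] 2(1)[OF x(1)] 1(2)[OF x(1)] 2(2)[OF x(1)] uvw(2) by (auto simp: less_le)
      then have "(b1 - a1 \<bullet> x) / g > 0 \<or> (b2 - a2 \<bullet> x) / h > 0"
        using gh by (auto simp: zero_less_divide_iff)
      moreover have "(b1 - a1 \<bullet> x) / g \<ge> 0" "(b2 - a2 \<bullet> x) / h \<ge> 0"
        using gh 1(1)[OF x(1)] 2(1)[OF x(1)] by simp_all
      ultimately show "a \<bullet> x < b"
        unfolding ax by linarith
    qed
  qed
qed

text \<open>For small \<open>e\<close> the point is close to the first argument. Exchanging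
  \<open>x\<close> and \<open>y\<close> gives the other new corner on the same side, so the pair of
  new corners does not depend on the orientation.\<close>

definition mix :: "real \<Rightarrow> 'a::real_vector \<Rightarrow> 'a \<Rightarrow> 'a" where
  "mix e x y = (1 - e) *\<^sub>R x + e *\<^sub>R y"

text \<open>Indices \<open>2 * i\<close> and \<open>2 * i + 1\<close> are the new corners on side
  \<open>i\<close>, near its start and near its end. Consequently the even sides of the truncated
  polygon are shortened old sides, and side \<open>2 * i + 1\<close> cuts off the corner
  \<open>Suc i\<close>.\<close>

definition trunc_corner :: "real \<Rightarrow> corners \<Rightarrow> nat \<Rightarrow> real ^ 3" where
  "trunc_corner e p j =
     (if even j then mix e (corner p (j div 2)) (corner p (Suc (j div 2)))
      else mix e (corner p (Suc (j div 2))) (corner p (j div 2)))"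

definition truncate_corners :: "real \<Rightarrow> corners \<Rightarrow> corners" where
  "truncate_corners e p = map (trunc_corner e p) [0..<2 * length p]"

lemma corner_truncate:
  assumes "0 < length p"
  shows "corner (truncate_corners e p) j = trunc_corner e p j"
proof -
  let ?n = "length p"
  have "j mod (2 * ?n) = 2 * (j div 2 mod ?n) + j mod 2"
    by (rule mod_mult2_eq)
  then have "(j mod (2 * ?n)) div 2 = j div 2 mod ?n" "even (j mod (2 * ?n)) \<longleftrightarrow> even j"
    by auto
  moreover have "corner p (Suc (j div 2 mod ?n)) = corner p (Suc (j div 2))"
    by (metis corner_mod mod_Suc_eq)
  ultimately have "trunc_corner e p (j mod (2 * ?n)) = trunc_corner e p j"
    unfolding trunc_corner_def by simp
  then show ?thesis
    using assms unfolding truncate_corners_def corner_def by simp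
qed

lemma side_truncate:
  assumes "0 < length p"
  shows "side (truncate_corners e p) (2 * i) =
    closed_segment (mix e (corner p i) (corner p (Suc i))) (mix e (corner p (Suc i)) (corner p i))"
  by (simp add: side_def corner_truncate[OF assms] trunc_corner_def)

lemma set_truncateE:
  assumes "0 < length p" "x \<in> set (truncate_corners e p)"
  obtains k where "x = mix e (corner p k) (corner p (Suc k))"
    | k where "x = mix e (corner p (Suc k)) (corner p k)"
proof -
  obtain j where "x = trunc_corner e p j"
    using assms unfolding truncate_corners_def by auto
  then show thesis
    using that unfolding trunc_corner_def by (auto split: if_splits)
qed

section \<open>Admissible truncation ratios\<close>

lemma eventually_trunc_bound:
  assumes "finite V" and pos: "\<And>x. x \<in> V \<Longrightarrow> a \<bullet> x < b"
  shows "\<forall>\<^sub>F e in at_right (0::real). \<forall>x\<in>V. e < (1 - e) * (b - a \<bullet> x)"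
proof (intro eventually_ball_finite[OF \<open>finite V\<close>] ballI)
  fix x assume "x \<in> V"
  then have f: "b - a \<bullet> x > 0"
    using pos by simp
  have "\<forall>\<^sub>F e in at_right (0::real). e \<in> {0<..<(b - a \<bullet> x) / (1 + (b - a \<bullet> x))}"
    using f by (intro eventually_at_right_real) simp
  then show "\<forall>\<^sub>F e in at_right (0::real). e < (1 - e) * (b - a \<bullet> x)"
  proof eventually_elim
    case (elim e)
    \<comment> \<open>For the gap \<open>g = b - a \<bullet> x\<close>, the bound
      \<open>g / (1 + g)\<close> is the inequality \<open>e < (1 - e) * g\<close> solved for
      \<open>e\<close>.\<close>
    then have "e * (1 + (b - a \<bullet> x)) < b - a \<bullet> x"
      using f by (simp add: pos_less_divide_eq)
    then show ?case
      by (simp add: algebra_simps)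
  qed
qed

text \<open>The line cutting off a corner runs at depth \<open>e\<close>. The inequality says that a
  new corner near any other old corner \<open>x\<close> is deeper than that even if its second end
  contributes nothing. As it holds for all small positive \<open>e\<close>, one ratio can serve all
  polygons of a finite surface.\<close>

definition truncatable :: "real \<Rightarrow> corners \<Rightarrow> bool" where
  "truncatable e p \<longleftrightarrow> 0 < e \<and> e < 1 \<and>
     (\<forall>i<length p. \<exists>a b. a \<bullet> corner p (Suc i) = b \<and> a \<bullet> corner p i = b - 1 \<and>
        a \<bullet> corner p (Suc (Suc i)) = b - 1 \<and>
        (\<forall>x\<in>set p. a \<bullet> x \<le> b \<and> (x \<noteq> corner p (Suc i) \<longrightarrow> e < (1 - e) * (b - a \<bullet> x))))"

lemma eventually_truncatable:
  assumes p: "convex_corners p"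
  shows "\<forall>\<^sub>F e in at_right 0. truncatable e p"
proof -
  have "\<forall>\<^sub>F e in at_right 0. \<exists>a b. a \<bullet> corner p (Suc i) = b \<and> a \<bullet> corner p i = b - 1 \<and>
      a \<bullet> corner p (Suc (Suc i)) = b - 1 \<and>
      (\<forall>x\<in>set p. a \<bullet> x \<le> b \<and> (x \<noteq> corner p (Suc i) \<longrightarrow> e < (1 - e) * (b - a \<bullet> x)))" for i
  proof -
    obtain a b where ab: "a \<bullet> corner p (Suc i) = b" "a \<bullet> corner p i = b - 1"
      "a \<bullet> corner p (Suc (Suc i)) = b - 1" "\<forall>x\<in>set p. x \<noteq> corner p (Suc i) \<longrightarrow> a \<bullet> x < b"
      by (rule corner_functional[OF p])
    have "\<forall>\<^sub>F e in at_right (0::real). \<forall>x\<in>set p - {corner p (Suc i)}. e < (1 - e) * (b - a \<bullet> x)"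
      using ab(4) by (intro eventually_trunc_bound) auto
    then show ?thesis
    proof eventually_elim
      case (elim e)
      show ?case
        using ab elim by (intro exI[of _ a] exI[of _ b]) (auto simp: less_imp_le)
    qed
  qed
  then have "\<forall>\<^sub>F e in at_right 0. \<forall>i\<in>{..<length p}. \<exists>a b. a \<bullet> corner p (Suc i) = b \<and>
      a \<bullet> corner p i = b - 1 \<and> a \<bullet> corner p (Suc (Suc i)) = b - 1 \<and>
      (\<forall>x\<in>set p. a \<bullet> x \<le> b \<and> (x \<noteq> corner p (Suc i) \<longrightarrow> e < (1 - e) * (b - a \<bullet> x)))"
    by (intro eventually_ball_finite) auto
  moreover have "\<forall>\<^sub>F e in at_right (0::real). e \<in> {0<..<1}"
    by (rule eventually_at_right_real) simp
  ultimately show ?thesis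
    by eventually_elim (auto simp: truncatable_def)
qed

lemma truncatable_functional:
  assumes p: "convex_corners p" and e: "truncatable e p"
  obtains a b where "a \<bullet> corner p (Suc i) = b" "a \<bullet> corner p i = b - 1"
    "a \<bullet> corner p (Suc (Suc i)) = b - 1"
    "\<And>x y. x \<in> set p \<Longrightarrow> y \<in> set p \<Longrightarrow> x \<noteq> corner p (Suc i) \<Longrightarrow> a \<bullet> mix e x y < b - e"
proof -
  note pD = convex_cornersD[OF p]
  let ?i = "i mod length p"
  have eq: "corner p ?i = corner p i" "corner p (Suc ?i) = corner p (Suc i)"
    "corner p (Suc (Suc ?i)) = corner p (Suc (Suc i))"
    by (metis corner_mod mod_Suc_eq)+
  have "?i < length p"
    using pD(2) by simp
  then obtain a b where ab: "a \<bullet> corner p (Suc i) = b" "a \<bullet> corner p i = b - 1"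
    "a \<bullet> corner p (Suc (Suc i)) = b - 1"
    "\<And>x. x \<in> set p \<Longrightarrow> a \<bullet> x \<le> b"
    "\<And>x. x \<in> set p \<Longrightarrow> x \<noteq> corner p (Suc i) \<Longrightarrow> e < (1 - e) * (b - a \<bullet> x)"
    using e unfolding truncatable_def by (metis (no_types, lifting) eq)
  show thesis
  proof (rule that[OF ab(1-3)])
    fix x y assume xy: "x \<in> set p" "y \<in> set p" "x \<noteq> corner p (Suc i)"
    have "a \<bullet> mix e x y = b - ((1 - e) * (b - a \<bullet> x) + e * (b - a \<bullet> y))"
      by (simp add: mix_def inner_add_right algebra_simps)
    moreover have "e * (b - a \<bullet> y) \<ge> 0"
      using e ab(4)[OF xy(2)] by (simp add: truncatable_def)
    ultimately show "a \<bullet> mix e x y < b - e"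
      using ab(5)[OF xy(1,3)] by linarith
  qed
qed

text \<open>A shortened side keeps the functional of the old side, which is strict at every mixture
  of the ends of another side. A side that cuts off a corner uses the functional of that corner,
  lowered by \<open>e\<close>.\<close>

lemma convex_corners_truncate:
  assumes p: "convex_corners p" and e: "truncatable e p"
  shows "convex_corners (truncate_corners e p)"
proof (rule convex_cornersI)
  note pD = convex_cornersD[OF p]
  let ?n = "length p" and ?t = "truncate_corners e p"
  have e01: "0 < e" "e < 1"
    using e by (auto simp: truncatable_def)
  have len: "length ?t = 2 * ?n"
    by (simp add: truncate_corners_def)
  show "3 \<le> length ?t"
    using pD(1) len by simp
  have mix_aff: "mix e x y \<in> affine hull (set p)" if "x \<in> set p" "y \<in> set p" for x y
    unfolding mix_def using that hull_subset[of "set p" affine]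
    by (intro mem_affine[OF affine_affine_hull]) auto
  have "set ?t \<subseteq> affine hull (set p)"
  proof
    fix x assume "x \<in> set ?t"
    then show "x \<in> affine hull (set p)"
      by (rule set_truncateE[OF pD(2)]) (simp_all add: mix_aff corner_in_set[OF pD(2)])
  qed
  then show "aff_dim (set ?t) \<le> 2"
    using aff_dim_subset pD(4) by (metis aff_dim_affine_hull)
  fix j assume "j < length ?t"
  then have j: "j < 2 * ?n"
    using len by simp
  have nth: "?t ! k = trunc_corner e p k" if "k < 2 * ?n" for k
    using that by (simp add: truncate_corners_def)
  define i where "i = j div 2"
  have i: "i < ?n"
    using j i_def by auto
  show "\<exists>a b. a \<bullet> ?t ! j = b \<and> a \<bullet> corner ?t (Suc j) = b \<and>
      (\<forall>k<length ?t. k \<noteq> j \<longrightarrow> k \<noteq> Suc j mod length ?t \<longrightarrow> a \<bullet> ?t ! k < b)"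
  proof (cases "even j")
    case True
    then have ji: "j = 2 * i"
      using i_def by simp
    obtain a b where ab: "\<And>x. x \<in> set p \<Longrightarrow> a \<bullet> x \<le> b"
      "\<And>x. x \<in> set p \<Longrightarrow> a \<bullet> x = b \<longleftrightarrow> x = corner p i \<or> x = corner p (Suc i)"
      by (rule convex_corners_functional[OF p, of i]) (rule that; blast)
    have "a \<bullet> corner p i = b" "a \<bullet> corner p (Suc i) = b"
      using ab(2) corner_in_set[OF pD(2)] by blast+
    then have "a \<bullet> trunc_corner e p j = b" "a \<bullet> trunc_corner e p (Suc j) = b"
      unfolding ji trunc_corner_def mix_def by (simp_all add: functional_convex_combination_eq)
    moreover have "a \<bullet> trunc_corner e p k < b" if k: "k < 2 * ?n" "k \<noteq> j" "k \<noteq> Suc j" for k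
    proof -
      have "k div 2 \<noteq> i"
        using k(2,3) ji by (metis even_two_times_div_two odd_two_times_div_two_succ Suc_eq_plus1)
      moreover have "k div 2 < ?n"
        using k by auto
      ultimately have "\<not> (a \<bullet> corner p (k div 2) = b \<and> a \<bullet> corner p (Suc (k div 2)) = b)"
        using functional_not_both_ends[OF p _ ab(2)] i by simp
      then show ?thesis
        unfolding trunc_corner_def mix_def
        using functional_convex_combination_less[OF e01 ab(1) ab(1)] corner_in_set[OF pD(2)] by auto
    qed
    moreover have "Suc j mod (2 * ?n) = Suc j"
      using ji i by simp
    ultimately show ?thesis
      using j by (intro exI[of _ a] exI[of _ b]) (simp add: corner_truncate[OF pD(2)] len nth)
  next
    case False
    then have ji: "j = 2 * i + 1"
      using i_def by presburger
    obtain a b where ab: "a \<bullet> corner p (Suc i) = b" "a \<bullet> corner p i = b - 1"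
      "a \<bullet> corner p (Suc (Suc i)) = b - 1"
      "\<And>x y. x \<in> set p \<Longrightarrow> y \<in> set p \<Longrightarrow> x \<noteq> corner p (Suc i) \<Longrightarrow> a \<bullet> mix e x y < b - e"
      by (rule truncatable_functional[OF p e, of i]) (rule that; blast)
    have tj: "trunc_corner e p j = mix e (corner p (Suc i)) (corner p i)"
      "trunc_corner e p (Suc j) = mix e (corner p (Suc i)) (corner p (Suc (Suc i)))"
      unfolding ji trunc_corner_def by simp_all
    have "a \<bullet> trunc_corner e p j = b - e" "a \<bullet> trunc_corner e p (Suc j) = b - e"
      unfolding tj mix_def inner_add_right inner_scaleR_right ab(1-3) by (simp_all add: algebra_simps)
    moreover have "a \<bullet> trunc_corner e p k < b - e"
      if k: "k < 2 * ?n" "k \<noteq> j" "k \<noteq> Suc j mod (2 * ?n)" for k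
    proof (cases "even k")
      case True
      then obtain l where l: "k = 2 * l" "l < ?n"
        using k(1) by auto
      \<comment> \<open>At the last side \<open>Suc j\<close> equals \<open>2 * ?n\<close> and wraps
        around to 0, so the cyclic index is compared through its half.\<close>
      have "Suc j mod (2 * ?n) = 2 * (Suc i mod ?n)"
      proof -
        have "Suc j = 2 * Suc i"
          using ji by simp
        then show ?thesis
          by (simp only: mod_mult_mult1)
      qed
      then have "l mod ?n \<noteq> Suc i mod ?n"
        using l k(3) by auto
      then have "corner p l \<noteq> corner p (Suc i)"
        using corner_eq_iff[OF pD(3,2)] by blast
      then show ?thesis
        using ab(4) corner_in_set[OF pD(2)] unfolding l trunc_corner_def by simp
    next
      case False
      then obtain l where l: "k = 2 * l + 1"
        using oddE by blast
      then have "l \<noteq> i" "l < ?n"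
        using k ji by auto
      then have "l mod ?n \<noteq> i mod ?n"
        using i by simp
      then have "Suc l mod ?n \<noteq> Suc i mod ?n"
        by (auto simp: mod_Suc split: if_splits)
      then have "corner p (Suc l) \<noteq> corner p (Suc i)"
        using corner_eq_iff[OF pD(3,2)] by blast
      then show ?thesis
        using ab(4) corner_in_set[OF pD(2)] unfolding l trunc_corner_def by simp
    qed
    ultimately show ?thesis
      using j by (intro exI[of _ a] exI[of _ "b - e"]) (simp add: corner_truncate[OF pD(2)] len nth)
  qed
qed

section \<open>The truncated polygon inside the original one\<close>

lemma conv_truncate_subset:
  assumes p: "0 < length p" and e: "0 < e" "e < 1"
  shows "conv (truncate_corners e p) \<subseteq> conv p"
proof (intro hull_minimal subsetI)
  fix x assume "x \<in> set (truncate_corners e p)"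
  moreover have "mix e v w \<in> conv p" if "v \<in> set p" "w \<in> set p" for v w
    unfolding mix_def using that e by (intro convexD[OF convex_convex_hull]) (auto simp: hull_inc)
  ultimately show "x \<in> conv p"
    using corner_in_set[OF p] by (elim set_truncateE[OF p]) auto
qed simp

text \<open>The functional of the corner takes the value \<open>b\<close> there but at most
  \<open>b - e\<close> at all new corners, with equality at the two next to it.\<close>

lemma corner_notin_conv_truncate:
  assumes p: "convex_corners p" and e: "truncatable e p" and x: "x \<in> set p"
  shows "x \<notin> conv (truncate_corners e p)"
proof
  note pD = convex_cornersD[OF p]
  obtain k where k: "x = corner p k" "k < length p"
    using in_set_corner[OF x] by blast
  define i where "i = k + (length p - 1)"
  have "Suc i = k + length p * 1"
    using pD(2) by (simp add: i_def)
  then have xi: "x = corner p (Suc i)"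
    using k by (metis corner_add_mult_length)
  obtain a b where ab: "a \<bullet> corner p (Suc i) = b" "a \<bullet> corner p i = b - 1"
      "a \<bullet> corner p (Suc (Suc i)) = b - 1"
      "\<And>x y. x \<in> set p \<Longrightarrow> y \<in> set p \<Longrightarrow> x \<noteq> corner p (Suc i) \<Longrightarrow> a \<bullet> mix e x y < b - e"
    by (rule truncatable_functional[OF p e, of i]) (rule that; blast)
  have "0 < e"
    using e by (auto simp: truncatable_def)
  have eqs: "a \<bullet> mix e (corner p (Suc i)) (corner p i) = b - e"
    "a \<bullet> mix e (corner p (Suc i)) (corner p (Suc (Suc i))) = b - e"
    unfolding mix_def inner_add_right inner_scaleR_right ab(1-3) by (simp_all add: algebra_simps)
  have Suc_eq: "corner p (Suc k) = corner p (Suc l)" if "corner p k = corner p l" for k l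
    using that corner_eq_iff[OF pD(3,2)] by (metis mod_Suc_eq)
  have pred_eq: "corner p k = corner p i" if "corner p (Suc k) = corner p (Suc i)" for k
    using that corner_eq_iff[OF pD(3,2)] by (auto simp: mod_Suc split: if_splits)
  have "a \<bullet> y \<le> b - e" if "y \<in> set (truncate_corners e p)" for y
  proof (rule set_truncateE[OF pD(2) that])
    fix k assume y: "y = mix e (corner p k) (corner p (Suc k))"
    show ?thesis
    proof (cases "corner p k = corner p (Suc i)")
      case True
      then show ?thesis
        using eqs(2) Suc_eq[OF True] unfolding y True by simp
    next
      case False
      then show ?thesis
        using ab(4) corner_in_set[OF pD(2)] unfolding y by (simp add: less_imp_le)
    qed
  next
    fix k assume y: "y = mix e (corner p (Suc k)) (corner p k)"
    show ?thesis
    proof (cases "corner p (Suc k) = corner p (Suc i)")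
      case True
      then show ?thesis
        using eqs(1) pred_eq[OF True] unfolding y True by simp
    next
      case False
      then show ?thesis
        using ab(4) corner_in_set[OF pD(2)] unfolding y by (simp add: less_imp_le)
    qed
  qed
  then have "conv (truncate_corners e p) \<subseteq> {y. a \<bullet> y \<le> b - e}"
    by (intro hull_minimal) (auto simp: convex_halfspace_le)
  moreover assume "x \<in> conv (truncate_corners e p)"
  ultimately show False
    using ab(1) \<open>0 < e\<close> unfolding xi by auto
qed

text \<open>The side is named by its end points and not by an index. Applied to two polygons with
  this side, the lemma yields the same shortened segment for both, although their lists may traverse
  it in opposite directions.\<close>

lemma conv_truncate_Int_side:
  assumes p: "convex_corners p" and e: "truncatable e p" and xy: "closed_segment x y \<in> sides p"
  shows "conv (truncate_corners e p) \<inter> closed_segment x y = closed_segment (mix e x y) (mix e y x)"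
    and "closed_segment (mix e x y) (mix e y x) \<in> sides (truncate_corners e p)"
proof -
  note pD = convex_cornersD[OF p]
  let ?t = "truncate_corners e p"
  have e01: "0 < e" "e < 1"
    using e by (auto simp: truncatable_def)
  obtain i where i: "i < length p" "closed_segment x y = side p i"
    using xy unfolding sides_def by blast
  \<comment> \<open>A segment determines its ends only up to order; the symmetric pair of mixtures
    absorbs the difference.\<close>
  have "{x, y} = {corner p i, corner p (Suc i)}"
    using i(2) unfolding side_def closed_segment_eq .
  then have seg: "closed_segment (mix e x y) (mix e y x) = side ?t (2 * i)"
    unfolding side_truncate[OF pD(2)] doubleton_eq_iff using closed_segment_commute by metis
  have t: "convex_corners ?t"
    by (rule convex_corners_truncate[OF p e])
  then show "closed_segment (mix e x y) (mix e y x) \<in> sides ?t"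
    unfolding seg by (rule side_in_sides[OF convex_cornersD(2)])
  obtain a b where ab: "\<And>x. x \<in> conv p \<Longrightarrow> a \<bullet> x \<le> b" "conv p \<inter> {x. a \<bullet> x = b} = side p i"
    "\<And>x. x \<in> set p \<Longrightarrow> a \<bullet> x = b \<longleftrightarrow> x = corner p i \<or> x = corner p (Suc i)"
    by (rule side_exposed[OF p, of i]) (rule that; blast)
  have sub: "conv ?t \<subseteq> conv p"
    by (rule conv_truncate_subset[OF pD(2) e01])
  then have le: "a \<bullet> v \<le> b" if "v \<in> set ?t" for v
    using that ab(1) by (meson hull_inc subsetD)
  have on: "a \<bullet> corner p i = b" "a \<bullet> corner p (Suc i) = b"
    using ab(3) corner_in_set[OF pD(2)] by blast+
  \<comment> \<open>A proper mixture attains the maximum only if both of its corners do, which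
    leaves just the two new corners on side \<open>i\<close>.\<close>
  have "mix e (corner p k) (corner p l) \<in> {mix e (corner p i) (corner p (Suc i)), mix e (corner p (Suc i)) (corner p i)}"
    if "a \<bullet> mix e (corner p k) (corner p l) = b" "l = Suc k \<or> k = Suc l" for k l
  proof -
    have "a \<bullet> corner p k = b \<and> a \<bullet> corner p l = b"
      using that(1) functional_convex_combination_less[OF e01 ab(1) ab(1), of "corner p k" "corner p l"]
        corner_in_set[OF pD(2)] unfolding mix_def by (auto simp: hull_inc)
    then have "corner p k \<in> {corner p i, corner p (Suc i)}" "corner p l \<in> {corner p i, corner p (Suc i)}"
      using ab(3) corner_in_set[OF pD(2)] by blast+
    moreover have "corner p k \<noteq> corner p l"
      using that(2) corner_neq(1)[OF pD(3,1)] by metis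
    ultimately show ?thesis
      by auto
  qed
  then have "{v \<in> set ?t. a \<bullet> v = b} \<subseteq> {mix e (corner p i) (corner p (Suc i)), mix e (corner p (Suc i)) (corner p i)}"
    by (auto elim!: set_truncateE[OF pD(2)])
  then have "convex hull {v \<in> set ?t. a \<bullet> v = b} \<subseteq> side ?t (2 * i)"
    unfolding side_truncate[OF pD(2)] segment_convex_hull by (rule hull_mono)
  then have "conv ?t \<inter> {v. a \<bullet> v = b} \<subseteq> side ?t (2 * i)"
    using convex_hull_Int_supporting_hyperplane(2)[OF finite_set le] by simp
  then have "conv ?t \<inter> side p i \<subseteq> side ?t (2 * i)"
    using ab(2) by blast
  moreover have "side ?t (2 * i) \<subseteq> side p i"
  proof -
    have "mix e v w \<in> closed_segment v w" for v w :: "real ^ 3"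
      unfolding mix_def closed_segment_def using e01 by auto
    then have "mix e v w \<in> closed_segment v w" "mix e w v \<in> closed_segment v w" for v w :: "real ^ 3"
      by (metis closed_segment_commute)+
    then show ?thesis
      unfolding side_truncate[OF pD(2)] side_def[of p] by (intro closed_segment_subset) auto
  qed
  moreover have "side ?t (2 * i) \<subseteq> conv ?t"
    by (rule side_subset_conv[OF convex_cornersD(2)[OF t]])
  ultimately show "conv ?t \<inter> closed_segment x y = closed_segment (mix e x y) (mix e y x)"
    unfolding seg i(2) by blast
qed

section \<open>Surfaces whose polygons meet only along sides\<close>

definition side_contact :: "corners \<Rightarrow> corners \<Rightarrow> bool" where
  "side_contact p q \<longleftrightarrow> conv p \<inter> conv q = {} \<or> conv p \<inter> conv q \<in> sides p \<inter> sides q"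

text \<open>The invariant of all later constructions. Unlike in a polyhedral surface, single-corner
  contacts and triple points are excluded altogether.\<close>

definition side_surface :: "corners set \<Rightarrow> bool" where
  "side_surface S \<longleftrightarrow> finite S \<and> (\<forall>p\<in>S. convex_corners p) \<and> pairwise side_contact S \<and>
     (\<forall>p\<in>S. \<forall>q\<in>S. \<forall>r\<in>S. p \<noteq> q \<longrightarrow> p \<noteq> r \<longrightarrow> q \<noteq> r \<longrightarrow> conv p \<inter> conv q \<inter> conv r = {})"

lemma side_contact_commute: "side_contact p q \<longleftrightarrow> side_contact q p"
  by (auto simp: side_contact_def Int_commute)

lemma side_neq_empty: "s \<in> sides p \<Longrightarrow> s \<noteq> {}"
  by (auto simp: sides_def side_def)

text \<open>Adjacency can from here on be tested on hulls, without naming the common side.\<close>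

lemma sides_meet_iff:
  assumes "side_contact p q"
  shows "sides p \<inter> sides q \<noteq> {} \<longleftrightarrow> conv p \<inter> conv q \<noteq> {}"
proof
  assume "sides p \<inter> sides q \<noteq> {}"
  then obtain s where "s \<in> sides p" "s \<in> sides q"
    by blast
  then have "s \<subseteq> conv p" "s \<subseteq> conv q" "s \<noteq> {}"
    using sides_subset_conv[of p] sides_subset_conv[of q] side_neq_empty by blast+
  then show "conv p \<inter> conv q \<noteq> {}"
    by blast
next
  assume "conv p \<inter> conv q \<noteq> {}"
  then show "sides p \<inter> sides q \<noteq> {}"
    using assms unfolding side_contact_def by blast
qed

text \<open>A side is never the whole hull. With \<open>p = q\<close> this says that a polygon is
  not in side contact with itself, which gives injectivity of the truncation and the freshness of
  the pieces of a cut.\<close>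

lemma side_contact_conv_neq:
  assumes "convex_corners q" "side_contact p q"
  shows "\<not> conv q \<subseteq> conv p"
proof
  assume "conv q \<subseteq> conv p"
  then have "conv p \<inter> conv q = conv q"
    by blast
  moreover have "conv q \<noteq> {}"
    using convex_cornersD(2)[OF assms(1)] by simp
  ultimately have "conv q \<in> sides q"
    using assms(2) unfolding side_contact_def by simp
  then show False
    using side_neq_conv[OF assms(1)] by blast
qed

lemma side_surface_subset: "side_surface S \<Longrightarrow> T \<subseteq> S \<Longrightarrow> side_surface T"
  unfolding side_surface_def by (meson finite_subset pairwise_subset subset_iff)

text \<open>Two polygons in contact meet in a facet of each, and a proper face misses the relative
  interior. The condition on triples holds vacuously.\<close>

lemma side_surface_imp_convex_polyhedral:
  assumes S: "side_surface S"
  shows "convex_polyhedral_surface S"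
proof -
  have cc: "convex_corners p" if "p \<in> S" for p
    using S that unfolding side_surface_def by blast
  have reg: "region p = conv p" if "p \<in> S" for p
    by (rule region_convex_corners[OF cc[OF that]])
  have con: "conv p \<inter> conv q = {} \<or> conv p \<inter> conv q \<in> sides p \<inter> sides q"
    if "p \<in> S" "q \<in> S" "p \<noteq> q" for p q
    using S that unfolding side_surface_def pairwise_def side_contact_def by blast
  have disj: "rel_interior (conv p) \<inter> rel_interior (conv q) = {}"
    if pq: "p \<in> S" "q \<in> S" "p \<noteq> q" for p q
  proof (cases "conv p \<inter> conv q = {}")
    case True
    then show ?thesis
      using rel_interior_subset by blast
  next
    case False
    then obtain i where "conv p \<inter> conv q = side p i"
      using con[OF pq] unfolding sides_def by blast
    then have "(conv p \<inter> conv q) facet_of conv p"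
      using side_facet_of[OF cc[OF pq(1)]] by simp
    then have "conv p \<inter> conv q \<inter> rel_interior (conv p) = {}"
      by (metis face_of_disjoint_rel_interior facet_of_imp_face_of facet_of_irrefl)
    then show ?thesis
      using rel_interior_subset[of "conv p"] rel_interior_subset[of "conv q"] by blast
  qed
  have contact: "(\<exists>c \<in> set p \<inter> set q. region p \<inter> region q = {c}) \<or> region p \<inter> region q \<in> sides p \<inter> sides q"
    if "p \<in> S" "q \<in> S" "p \<noteq> q" "region p \<inter> region q \<noteq> {}" for p q
    using con[OF that(1-3)] that(4) unfolding reg[OF that(1)] reg[OF that(2)] by blast
  have triple: "region p \<inter> region q \<inter> region r = {}"
    if "p \<in> S" "q \<in> S" "r \<in> S" "p \<noteq> q" "p \<noteq> r" "q \<noteq> r" for p q r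
    using S that unfolding side_surface_def reg[OF that(1)] reg[OF that(2)] reg[OF that(3)] by blast
  have "finite S"
    using S unfolding side_surface_def by blast
  then show ?thesis
    unfolding convex_polyhedral_surface_def polyhedral_surface_def
    using cc convex_corners_imp_polygon contact triple by (simp add: reg disj)
qed

section \<open>Truncation of a whole surface\<close>

lemma ex_truncatable:
  assumes "finite S" "\<And>p. p \<in> S \<Longrightarrow> convex_corners p"
  shows "\<exists>e. \<forall>p\<in>S. truncatable e p"
proof -
  have "\<forall>\<^sub>F e in at_right 0. \<forall>p\<in>S. truncatable e p"
    using assms eventually_truncatable by (intro eventually_ball_finite) auto
  then show ?thesis
    using eventually_happens by force
qed

text \<open>Contacts other than common sides, as well as triple points, consist of corners of
  \<open>p\<close>, and these lie outside the truncated hull. A common side is shortened in the same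
  way from both polygons.\<close>

lemma truncate_surface:
  assumes S: "convex_polyhedral_surface S"
  obtains e where "inj_on (truncate_corners e) S" "side_surface (truncate_corners e ` S)"
    "\<forall>p\<in>S. \<forall>q\<in>S. p \<noteq> q \<longrightarrow>
      (sides p \<inter> sides q \<noteq> {} \<longleftrightarrow> conv (truncate_corners e p) \<inter> conv (truncate_corners e q) \<noteq> {})"
proof -
  have ps: "polyhedral_surface S" and sc: "\<And>p. p \<in> S \<Longrightarrow> strictly_convex p"
    using S unfolding convex_polyhedral_surface_def by auto
  have "finite S" and pg: "\<And>p. p \<in> S \<Longrightarrow> polygon p"
    using ps unfolding polyhedral_surface_def by auto
  have cc: "convex_corners p" if "p \<in> S" for p
    by (rule polygon_imp_convex_corners[OF pg[OF that] sc[OF that]])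
  then have reg: "region p = conv p" if "p \<in> S" for p
    using region_convex_corners that by blast
  have two: "conv p \<inter> conv q = {} \<or> (\<exists>c \<in> set p \<inter> set q. conv p \<inter> conv q = {c}) \<or>
        conv p \<inter> conv q \<in> sides p \<inter> sides q" if "p \<in> S" "q \<in> S" "p \<noteq> q" for p q
    using ps reg that unfolding polyhedral_surface_def by metis
  have three: "conv p \<inter> conv q \<inter> conv r = {} \<or> (\<exists>c \<in> set p. conv p \<inter> conv q \<inter> conv r = {c})"
    if pqr: "p \<in> S" "q \<in> S" "r \<in> S" "p \<noteq> q" "p \<noteq> r" "q \<noteq> r" for p q r
  proof -
    have "region p \<inter> region q \<inter> region r \<noteq> {} \<longrightarrow>
        (\<exists>c \<in> set p \<inter> set q \<inter> set r. region p \<inter> region q \<inter> region r = {c})"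
      using ps pqr unfolding polyhedral_surface_def by blast
    then show ?thesis
      unfolding reg[OF pqr(1)] reg[OF pqr(2)] reg[OF pqr(3)] by blast
  qed
  obtain e where e: "\<And>p. p \<in> S \<Longrightarrow> truncatable e p"
    using ex_truncatable[OF \<open>finite S\<close> cc] by blast
  let ?t = "truncate_corners e"
  have e01: "0 < e" "e < 1" if "p \<in> S" for p
    using e[OF that] unfolding truncatable_def by auto
  have tc: "convex_corners (?t p)" if "p \<in> S" for p
    by (rule convex_corners_truncate[OF cc[OF that] e[OF that]])
  have sub: "conv (?t p) \<subseteq> conv p" if "p \<in> S" for p
    by (rule conv_truncate_subset[OF convex_cornersD(2)[OF cc[OF that]] e01[OF that]])
  have notin: "c \<notin> conv (?t p)" if "p \<in> S" "c \<in> set p" for p c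
    by (rule corner_notin_conv_truncate[OF cc[OF that(1)] e[OF that(1)] that(2)])
  have key: "(conv p \<inter> conv q \<in> sides p \<inter> sides q \<and> conv (?t p) \<inter> conv (?t q) \<in> sides (?t p) \<inter> sides (?t q)) \<or>
      (conv p \<inter> conv q \<notin> sides p \<inter> sides q \<and> conv (?t p) \<inter> conv (?t q) = {})"
    if pq: "p \<in> S" "q \<in> S" "p \<noteq> q" for p q
  proof (cases "conv p \<inter> conv q \<in> sides p \<inter> sides q")
    case True
    then obtain i where "conv p \<inter> conv q = side p i"
      unfolding sides_def by blast
    then obtain x y where xy: "conv p \<inter> conv q = closed_segment x y"
      unfolding side_def by blast
    then have s: "closed_segment x y \<in> sides p" "closed_segment x y \<in> sides q"
      using True by auto
    note P = conv_truncate_Int_side[OF cc[OF pq(1)] e[OF pq(1)] s(1)]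
      and Q = conv_truncate_Int_side[OF cc[OF pq(2)] e[OF pq(2)] s(2)]
    have "conv (?t p) \<inter> conv (?t q) = (conv (?t p) \<inter> closed_segment x y) \<inter> (conv (?t q) \<inter> closed_segment x y)"
      using sub[OF pq(1)] sub[OF pq(2)] xy by blast
    then have "conv (?t p) \<inter> conv (?t q) = closed_segment (mix e x y) (mix e y x)"
      unfolding P(1) Q(1) by simp
    then show ?thesis
      using True P(2) Q(2) by simp
  next
    case False
    then have "conv p \<inter> conv q = {} \<or> (\<exists>c\<in>set p. conv p \<inter> conv q = {c})"
      using two[OF pq] by blast
    then have "conv p \<inter> conv q \<subseteq> set p"
      by (metis empty_subsetI insert_subset)
    then have "conv (?t p) \<inter> conv (?t q) = {}"
      using sub[OF pq(1)] sub[OF pq(2)] notin[OF pq(1)] by blast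
    then show ?thesis
      using False by blast
  qed
  have contact: "side_contact (?t p) (?t q)" if "p \<in> S" "q \<in> S" "p \<noteq> q" for p q
    using key[OF that] unfolding side_contact_def by blast
  have inj: "inj_on ?t S"
  proof (rule inj_onI, rule ccontr)
    fix p q assume "p \<in> S" "q \<in> S" "?t p = ?t q" "p \<noteq> q"
    then show False
      using side_contact_conv_neq[OF tc contact, of q p] by auto
  qed
  moreover have "side_surface (?t ` S)"
    unfolding side_surface_def
  proof (intro conjI)
    show "finite (?t ` S)"
      using \<open>finite S\<close> by simp
    show "\<forall>p\<in>?t ` S. convex_corners p"
      using tc by blast
    show "pairwise side_contact (?t ` S)"
      unfolding pairwise_def using contact by blast
    have "conv (?t p) \<inter> conv (?t q) \<inter> conv (?t r) = {}"
      if pqr: "p \<in> S" "q \<in> S" "r \<in> S" "p \<noteq> q" "p \<noteq> r" "q \<noteq> r" for p q r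
    proof -
      have "conv p \<inter> conv q \<inter> conv r \<subseteq> set p"
        using three[OF pqr] by (metis empty_subsetI insert_subset)
      then show ?thesis
        using sub[OF pqr(1)] sub[OF pqr(2)] sub[OF pqr(3)] notin[OF pqr(1)] by blast
    qed
    then show "\<forall>p\<in>?t ` S. \<forall>q\<in>?t ` S. \<forall>r\<in>?t ` S. p \<noteq> q \<longrightarrow> p \<noteq> r \<longrightarrow> q \<noteq> r \<longrightarrow>
      conv p \<inter> conv q \<inter> conv r = {}"
      by blast
  qed
  moreover have "sides p \<inter> sides q \<noteq> {} \<longleftrightarrow> conv (?t p) \<inter> conv (?t q) \<noteq> {}"
    if pq: "p \<in> S" "q \<in> S" "p \<noteq> q" for p q
  proof -
    \<comment> \<open>A common side has two different ends, so the intersection of the hulls is not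
      a single point, and the contact condition forces it to be a complete common side.\<close>
    have "sides p \<inter> sides q \<noteq> {} \<longleftrightarrow> conv p \<inter> conv q \<in> sides p \<inter> sides q"
    proof
      assume "sides p \<inter> sides q \<noteq> {}"
      then obtain i where i: "side p i \<in> sides q" "i < length p"
        unfolding sides_def by blast
      then have "side p i \<subseteq> conv p \<inter> conv q"
        using sides_subset_conv[of p] sides_subset_conv[of q] unfolding sides_def by blast
      then have "corner p i \<in> conv p \<inter> conv q" "corner p (Suc i) \<in> conv p \<inter> conv q"
        using corner_in_side by blast+
      moreover have "corner p i \<noteq> corner p (Suc i)"
        using corner_neq(1) convex_cornersD[OF cc[OF pq(1)]] by blast
      ultimately show "conv p \<inter> conv q \<in> sides p \<inter> sides q"
        using two[OF pq] by (metis empty_iff singletonD)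
    qed blast
    then show ?thesis
      using key[OF pq] side_neq_empty by blast
  qed
  ultimately show thesis
    by (intro that[of e]) simp_all
qed

text \<open>A third polygon \<open>r\<close> that meets \<open>p\<close> does so in a side disjoint
  from \<open>s\<close>, since a common point would lie in \<open>p\<close>, \<open>q\<close> and
  \<open>r\<close>. Such sides pass unchanged to \<open>p'\<close> and miss
  \<open>R\<close>.\<close>

lemma subdivide_surface:
  assumes S: "side_surface S" and pq: "p \<in> S" "q \<in> S" "p \<noteq> q" "conv p \<inter> conv q \<noteq> {}"
  obtains p' R where "side_surface (insert p' (insert R (S - {p})))"
    "p' \<notin> S - {p}" "R \<notin> S - {p}" "p' \<noteq> R"
    "conv p' \<inter> conv R \<noteq> {}" "conv R \<inter> conv q \<noteq> {}" "conv p' \<inter> conv q = {}"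
    "\<forall>r\<in>S - {p, q}. (conv p' \<inter> conv r \<noteq> {} \<longleftrightarrow> conv p \<inter> conv r \<noteq> {}) \<and> conv R \<inter> conv r = {}"
proof -
  have cc: "convex_corners r" if "r \<in> S" for r
    using S that unfolding side_surface_def by blast
  have con: "side_contact a b" if "a \<in> S" "b \<in> S" "a \<noteq> b" for a b
    using S that unfolding side_surface_def pairwise_def by blast
  have triple: "conv a \<inter> conv b \<inter> conv c = {}"
    if "a \<in> S" "b \<in> S" "c \<in> S" "a \<noteq> b" "a \<noteq> c" "b \<noteq> c" for a b c
    using S that unfolding side_surface_def by blast
  define s where "s = conv p \<inter> conv q"
  have s: "s \<in> sides p" "s \<in> sides q" "s \<noteq> {}"
    using con[OF pq(1-3)] pq(4) unfolding side_contact_def s_def by auto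
  obtain p' R where c: "convex_corners p'" "convex_corners R" and
    sub: "conv p' \<subseteq> conv p" "conv R \<subseteq> conv p" and sR: "s \<in> sides R" and
    pR: "conv p' \<inter> conv R \<in> sides p' \<inter> sides R" and ps: "conv p' \<inter> s = {}" and
    rest: "\<forall>t\<in>sides p. t \<inter> s = {} \<longrightarrow> t \<in> sides p' \<and> conv R \<inter> t = {}"
    by (rule cut_side[OF cc[OF pq(1)] s(1)]) (rule that; assumption)
  have sR': "s \<subseteq> conv R"
    using sR sides_subset_conv by blast
  have p'q: "conv p' \<inter> conv q = {}"
    using sub(1) ps unfolding s_def by blast
  have Rq: "conv R \<inter> conv q = s"
    using sub(2) sR' unfolding s_def by blast
  have others: "conv R \<inter> conv r = {}" "conv p' \<inter> conv r = conv p \<inter> conv r" "side_contact p' r"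
    if r: "r \<in> S - {p, q}" for r
  proof -
    have "r \<in> S" "r \<noteq> p" "r \<noteq> q"
      using r by auto
    then have disj: "(conv p \<inter> conv r) \<inter> s = {}"
      using triple[OF pq(1,2)] pq(3) unfolding s_def by blast
    have pr: "conv p \<inter> conv r = {} \<or> conv p \<inter> conv r \<in> sides p \<inter> sides r"
      using con[OF pq(1) \<open>r \<in> S\<close>] \<open>r \<noteq> p\<close> unfolding side_contact_def by blast
    then have pr': "conv p \<inter> conv r = {} \<or> conv p \<inter> conv r \<in> sides p' \<and> conv R \<inter> (conv p \<inter> conv r) = {}"
      using rest disj by blast
    then show "conv R \<inter> conv r = {}"
      using sub(2) by blast
    show eq: "conv p' \<inter> conv r = conv p \<inter> conv r"
      using pr' sub(1) sides_subset_conv[of p'] by blast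
    show "side_contact p' r"
      unfolding side_contact_def eq using pr pr' by blast
  qed
  have con': "side_contact p' r" "side_contact R r" if "r \<in> S - {p}" for r
  proof -
    show "side_contact p' r"
      using p'q others(3)[of r] that unfolding side_contact_def by blast
    show "side_contact R r"
      using Rq sR s(2) others(1)[of r] that unfolding side_contact_def by (cases "r = q") auto
  qed
  have p'R: "side_contact p' R"
    using pR unfolding side_contact_def by blast
  have new: "p' \<notin> S - {p}" "R \<notin> S - {p}"
    using con'(1)[of p'] con'(2)[of R] side_contact_conv_neq[OF c(1)] side_contact_conv_neq[OF c(2)]
    by blast+
  have "side_surface (insert p' (insert R (S - {p})))"
    unfolding side_surface_def
  proof (intro conjI)
    show "finite (insert p' (insert R (S - {p})))"
      using S unfolding side_surface_def by simp
    show "\<forall>r\<in>insert p' (insert R (S - {p})). convex_corners r"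
      using c cc by blast
    show "pairwise side_contact (insert p' (insert R (S - {p})))"
      unfolding pairwise_insert
      using con' p'R con by (auto simp: side_contact_commute pairwise_def)
    have T: False if "x \<in> conv a" "x \<in> conv b" "x \<in> conv c"
      "a \<in> S" "b \<in> S" "c \<in> S" "a \<noteq> b" "a \<noteq> c" "b \<noteq> c" for a b c x
      using triple that by blast
    \<comment> \<open>Both pieces lie in \<open>p\<close>, so one piece together with two old
      polygons would give a triple point of \<open>S\<close>.\<close>
    have P: False if "x \<in> conv p' \<or> x \<in> conv R" "x \<in> conv a" "x \<in> conv b"
      "a \<in> S - {p}" "b \<in> S - {p}" "a \<noteq> b" for a b x
      using T[of x p a b] that sub pq(1) by blast
    \<comment> \<open>Among the remaining old polygons the strip meets only \<open>q\<close>, and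
      \<open>p'\<close> misses \<open>q\<close>.\<close>
    have Q: False if "x \<in> conv p'" "x \<in> conv R" "x \<in> conv a" "a \<in> S - {p}" for a x
      using that others(1)[of a] p'q by blast
    have "False" if x: "x \<in> conv a" "x \<in> conv b" "x \<in> conv c"
      and abc: "a \<in> insert p' (insert R (S - {p}))" "b \<in> insert p' (insert R (S - {p}))"
        "c \<in> insert p' (insert R (S - {p}))" "a \<noteq> b" "a \<noteq> c" "b \<noteq> c" for a b c x
    proof -
      have mem: "a = p' \<or> a = R \<or> a \<in> S - {p}" "b = p' \<or> b = R \<or> b \<in> S - {p}" "c = p' \<or> c = R \<or> c \<in> S - {p}"
        using abc by auto
      show False
        using mem(1)
      proof (elim disjE)
        assume "a = p'"
        then show False
          using mem(2,3) abc(4-6) x Q[of x] P[of x] by metis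
      next
        assume "a = R"
        then show False
          using mem(2,3) abc(4-6) x Q[of x] P[of x] by metis
      next
        assume "a \<in> S - {p}"
        then show False
          using mem(2,3) abc(4-6) x Q[of x] P[of x] T[of x a b c] by (metis DiffD1)
      qed
    qed
    then show "\<forall>a\<in>insert p' (insert R (S - {p})). \<forall>b\<in>insert p' (insert R (S - {p})).
      \<forall>c\<in>insert p' (insert R (S - {p})). a \<noteq> b \<longrightarrow> a \<noteq> c \<longrightarrow> b \<noteq> c \<longrightarrow> conv a \<inter> conv b \<inter> conv c = {}"
      by blast
  qed
  moreover have "p' \<noteq> R"
    using sR' ps s(3) by blast
  moreover have "conv p' \<inter> conv R \<noteq> {}"
    using pR side_neq_empty by blast
  moreover have "conv R \<inter> conv q \<noteq> {}"
    using Rq s(3) by simp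
  ultimately show thesis
    using that[of p' R] new p'q others(1,2) by simp
qed

section \<open>Graphs realized by such surfaces\<close>

text \<open>A placement of the vertices instead of an isomorphism record, so that a cut becomes a
  function update. Equal vertices are exempt because every polygon meets itself while the graphs
  have no loops.\<close>

definition realizes :: "('a \<Rightarrow> corners) \<Rightarrow> 'a pair_pre_digraph \<Rightarrow> bool" where
  "realizes f G \<longleftrightarrow> inj_on f (pverts G) \<and> side_surface (f ` pverts G) \<and>
     (\<forall>u\<in>pverts G. \<forall>v\<in>pverts G. u \<noteq> v \<longrightarrow>
        ((u, v) \<in> parcs G \<longleftrightarrow> conv (f u) \<inter> conv (f v) \<noteq> {}))"

text \<open>From left to right the given surface is truncated, which preserves adjacency. From right
  to left the placed polygons already form a convex-polyhedral surface, in which sharing a side and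
  meeting are the same.\<close>

lemma convex_surface_graph_iff_realizes:
  assumes "pair_graph G"
  shows "convex_surface_graph G \<longleftrightarrow> (\<exists>f. realizes f G)"
proof
  interpret pair_graph G by fact
  assume "convex_surface_graph G"
  then obtain S h where S: "convex_polyhedral_surface S"
    and h: "pre_digraph.digraph_isomorphism (with_proj G) h" "with_proj (adjacency_graph S) = app_iso h (with_proj G)"
    unfolding convex_surface_graph_def digraph_iso_def by blast
  have inj: "inj_on (iso_verts h) (pverts G)"
    and ends: "\<And>a. a \<in> parcs G \<Longrightarrow> iso_verts h (fst a) = iso_tail h (iso_arcs h a) \<and>
      iso_verts h (snd a) = iso_head h (iso_arcs h a)"
    using h(1) unfolding pre_digraph.digraph_isomorphism_def by auto
  have verts: "S = iso_verts h ` pverts G"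
    using arg_cong[OF h(2), of verts] by (simp add: adjacency_graph_def)
  have arcs: "parcs (adjacency_graph S) = iso_arcs h ` parcs G"
    using arg_cong[OF h(2), of arcs] by simp
  \<comment> \<open>Both graphs use the projections as tail and head, so the map on arcs is
    determined by the map on vertices.\<close>
  have tail: "iso_tail h = fst" and head: "iso_head h = snd"
    using arg_cong[OF h(2), of tail] arg_cong[OF h(2), of head] by simp_all
  have "iso_arcs h a = (iso_verts h (fst a), iso_verts h (snd a))" if "a \<in> parcs G" for a
    using ends[OF that] unfolding tail head by (simp add: prod_eq_iff)
  then have arcs': "parcs (adjacency_graph S) = (\<lambda>a. (iso_verts h (fst a), iso_verts h (snd a))) ` parcs G"
    unfolding arcs by simp
  have adj: "(u, v) \<in> parcs G \<longleftrightarrow> sides (iso_verts h u) \<inter> sides (iso_verts h v) \<noteq> {}"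
    if uv: "u \<in> pverts G" "v \<in> pverts G" "u \<noteq> v" for u v
  proof -
    have "(u, v) \<in> parcs G \<longleftrightarrow> (iso_verts h u, iso_verts h v) \<in> parcs (adjacency_graph S)"
    proof
      assume "(iso_verts h u, iso_verts h v) \<in> parcs (adjacency_graph S)"
      then obtain a where a: "a \<in> parcs G" "iso_verts h u = iso_verts h (fst a)" "iso_verts h v = iso_verts h (snd a)"
        unfolding arcs' by auto
      then have "u = fst a" "v = snd a"
        using inj uv arc_fst_in_verts arc_snd_in_verts by (auto dest: inj_onD)
      then show "(u, v) \<in> parcs G"
        using a(1) by simp
    qed (force simp: arcs')
    moreover have "iso_verts h u \<noteq> iso_verts h v"
      using inj uv by (auto dest: inj_onD)
    ultimately show ?thesis
      using uv verts by (auto simp: adjacency_graph_def)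
  qed
  obtain e where e: "inj_on (truncate_corners e) S" "side_surface (truncate_corners e ` S)"
    "\<forall>p\<in>S. \<forall>q\<in>S. p \<noteq> q \<longrightarrow>
      (sides p \<inter> sides q \<noteq> {} \<longleftrightarrow> conv (truncate_corners e p) \<inter> conv (truncate_corners e q) \<noteq> {})"
    by (rule truncate_surface[OF S])
  have "realizes (truncate_corners e \<circ> iso_verts h) G"
    unfolding realizes_def
  proof (intro conjI ballI impI)
    show "inj_on (truncate_corners e \<circ> iso_verts h) (pverts G)"
      using comp_inj_on[OF inj] e(1) verts by simp
    show "side_surface ((truncate_corners e \<circ> iso_verts h) ` pverts G)"
      using e(2) verts by (simp add: image_comp)
    fix u v assume uv: "u \<in> pverts G" "v \<in> pverts G" "u \<noteq> v"
    then have "iso_verts h u \<noteq> iso_verts h v" "iso_verts h u \<in> S" "iso_verts h v \<in> S"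
      using inj verts by (auto dest: inj_onD)
    then show "(u, v) \<in> parcs G \<longleftrightarrow>
      conv ((truncate_corners e \<circ> iso_verts h) u) \<inter> conv ((truncate_corners e \<circ> iso_verts h) v) \<noteq> {}"
      using adj[OF uv] e(3) by simp
  qed
  then show "\<exists>f. realizes f G"
    by blast
next
  interpret pair_graph G by fact
  assume "\<exists>f. realizes f G"
  then obtain f where inj: "inj_on f (pverts G)" and S: "side_surface (f ` pverts G)"
    and adj: "\<And>u v. u \<in> pverts G \<Longrightarrow> v \<in> pverts G \<Longrightarrow> u \<noteq> v \<Longrightarrow>
      (u, v) \<in> parcs G \<longleftrightarrow> conv (f u) \<inter> conv (f v) \<noteq> {}"
    unfolding realizes_def by blast
  define h where "h = \<lparr>iso_verts = f, iso_arcs = map_prod f f, iso_head = snd, iso_tail = fst\<rparr>"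
  have con: "side_contact p q" if "p \<in> f ` pverts G" "q \<in> f ` pverts G" "p \<noteq> q" for p q
    using S that unfolding side_surface_def pairwise_def by blast
  have "parcs (adjacency_graph (f ` pverts G)) = map_prod f f ` parcs G"
  proof (intro equalityI subsetI)
    fix x assume "x \<in> parcs (adjacency_graph (f ` pverts G))"
    then obtain u v where uv: "x = (f u, f v)" "u \<in> pverts G" "v \<in> pverts G" "f u \<noteq> f v"
      "sides (f u) \<inter> sides (f v) \<noteq> {}"
      unfolding adjacency_graph_def by auto
    then have "conv (f u) \<inter> conv (f v) \<noteq> {}"
      using sides_meet_iff[OF con] by blast
    then have "(u, v) \<in> parcs G"
      using adj uv by blast
    then show "x \<in> map_prod f f ` parcs G"
      using uv(1) by force
  next
    fix x assume "x \<in> map_prod f f ` parcs G"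
    then obtain u v where uv: "x = (f u, f v)" "(u, v) \<in> parcs G"
      by auto
    then have V: "u \<in> pverts G" "v \<in> pverts G" "u \<noteq> v"
      using in_arcsD1 in_arcsD2 no_loops' by blast+
    then have "f u \<noteq> f v"
      using inj by (auto dest: inj_onD)
    then have "sides (f u) \<inter> sides (f v) \<noteq> {}"
      using sides_meet_iff[OF con] adj[OF V] uv(2) V by blast
    then show "x \<in> parcs (adjacency_graph (f ` pverts G))"
      using V \<open>f u \<noteq> f v\<close> uv(1) unfolding adjacency_graph_def by simp
  qed
  then have "with_proj (adjacency_graph (f ` pverts G)) = app_iso h (with_proj G)"
    by (simp add: with_proj_def app_iso_def h_def) (simp add: adjacency_graph_def)
  moreover have "inj_on (map_prod f f) (parcs G)"
    using inj_on_subset[OF map_prod_inj_on[OF inj inj], of "parcs G"] in_arcsD1 in_arcsD2 by force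
  then have "pre_digraph.digraph_isomorphism (with_proj G) h"
    unfolding pre_digraph.digraph_isomorphism_def using inj wf_digraph_axioms by (simp add: h_def)
  ultimately show "convex_surface_graph G"
    using side_surface_imp_convex_polyhedral[OF S]
    unfolding convex_surface_graph_def digraph_iso_def by blast
qed

section \<open>Deleting vertices and edges\<close>

lemma realizes_restrict:
  assumes "realizes f G" "pverts H \<subseteq> pverts G"
    and "\<And>u v. u \<in> pverts H \<Longrightarrow> v \<in> pverts H \<Longrightarrow> u \<noteq> v \<Longrightarrow> (u, v) \<in> parcs H \<longleftrightarrow> (u, v) \<in> parcs G"
  shows "realizes f H"
  using assms inj_on_subset side_surface_subset[OF _ image_mono]
  unfolding realizes_def by (metis (no_types, lifting) subsetD)

lemma realizes_symmetric:
  assumes "realizes f G" "u \<in> pverts G" "v \<in> pverts G" "u \<noteq> v"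
  shows "(u, v) \<in> parcs G \<longleftrightarrow> (v, u) \<in> parcs G"
  using assms unfolding realizes_def by (metis Int_commute)

text \<open>The common source of edge deletion and edge subdivision: \<open>p'\<close> takes over
  all neighbours of \<open>u\<close> except \<open>v\<close>, and \<open>R\<close> touches only
  \<open>p'\<close> and the polygon of \<open>v\<close>.\<close>

lemma realizes_cut_edge:
  assumes f: "realizes f G" and uv: "u \<in> pverts G" "v \<in> pverts G" "u \<noteq> v" "(u, v) \<in> parcs G"
  obtains p' R where "side_surface (insert p' (insert R (f ` (pverts G - {u}))))"
    "p' \<notin> f ` (pverts G - {u})" "R \<notin> f ` (pverts G - {u})" "p' \<noteq> R"
    "conv p' \<inter> conv R \<noteq> {}" "conv p' \<inter> conv (f v) = {}"
    "\<forall>a\<in>pverts G - {u}. conv R \<inter> conv (f a) \<noteq> {} \<longleftrightarrow> a = v"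
    "\<forall>a\<in>pverts G - {u, v}. conv p' \<inter> conv (f a) \<noteq> {} \<longleftrightarrow> (u, a) \<in> parcs G"
proof -
  let ?V = "pverts G" and ?S = "f ` pverts G"
  have inj: "inj_on f ?V" and S: "side_surface ?S"
    and adj: "\<And>a b. a \<in> ?V \<Longrightarrow> b \<in> ?V \<Longrightarrow> a \<noteq> b \<Longrightarrow>
      (a, b) \<in> parcs G \<longleftrightarrow> conv (f a) \<inter> conv (f b) \<noteq> {}"
    using f unfolding realizes_def by blast+
  have fuv: "f u \<in> ?S" "f v \<in> ?S" "f u \<noteq> f v" "conv (f u) \<inter> conv (f v) \<noteq> {}"
    using uv adj[OF uv(1-3)] inj_on_eq_iff[OF inj uv(1,2)] by auto
  obtain p' R where S': "side_surface (insert p' (insert R (?S - {f u})))"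
    and new: "p' \<notin> ?S - {f u}" "R \<notin> ?S - {f u}" "p' \<noteq> R"
      "conv p' \<inter> conv R \<noteq> {}" and Rv: "conv R \<inter> conv (f v) \<noteq> {}" and
    p'v: "conv p' \<inter> conv (f v) = {}" and
    others: "\<forall>r\<in>?S - {f u, f v}. (conv p' \<inter> conv r \<noteq> {} \<longleftrightarrow> conv (f u) \<inter> conv r \<noteq> {}) \<and> conv R \<inter> conv r = {}"
    by (rule subdivide_surface[OF S fuv]) (rule that; assumption)
  have im: "?S - {f u} = f ` (?V - {u})"
    using inj_on_image_set_diff[OF inj, of ?V "{u}"] uv(1) by simp
  have ne: "f a \<in> ?S - {f u, f v}" if "a \<in> ?V - {u, v}" for a
    using that inj_on_eq_iff[OF inj, of a u] inj_on_eq_iff[OF inj, of a v] uv by auto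
  show thesis
  proof (rule that[OF S'[unfolded im] new(1,2)[unfolded im] new(3,4) p'v])
    show "\<forall>a\<in>?V - {u}. conv R \<inter> conv (f a) \<noteq> {} \<longleftrightarrow> a = v"
      using others ne Rv by blast
    show "\<forall>a\<in>?V - {u, v}. conv p' \<inter> conv (f a) \<noteq> {} \<longleftrightarrow> (u, a) \<in> parcs G"
    proof
      fix a assume a: "a \<in> ?V - {u, v}"
      then show "conv p' \<inter> conv (f a) \<noteq> {} \<longleftrightarrow> (u, a) \<in> parcs G"
        using others ne[OF a] adj[of u a] uv(1) by blast
    qed
  qed
qed

text \<open>The edge disappears together with the strip \<open>R\<close> that would subdivide it.\<close>

lemma realizes_delete_edge:
  assumes f: "realizes f G"
  shows "\<exists>f'. realizes f' \<lparr>pverts = pverts G, parcs = parcs G - {(u, v), (v, u)}\<rparr>"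
proof (cases "u \<in> pverts G \<and> v \<in> pverts G \<and> u \<noteq> v \<and> (u, v) \<in> parcs G")
  case False
  then have "realizes f \<lparr>pverts = pverts G, parcs = parcs G - {(u, v), (v, u)}\<rparr>"
    using realizes_symmetric[OF f] by (intro realizes_restrict[OF f]) auto
  then show ?thesis
    by blast
next
  case True
  then have uv: "u \<in> pverts G" "v \<in> pverts G" "u \<noteq> v" "(u, v) \<in> parcs G"
    by blast+
  let ?V = "pverts G"
  have inj: "inj_on f ?V"
    and adj: "\<And>a b. a \<in> ?V \<Longrightarrow> b \<in> ?V \<Longrightarrow> a \<noteq> b \<Longrightarrow>
      (a, b) \<in> parcs G \<longleftrightarrow> conv (f a) \<inter> conv (f b) \<noteq> {}"
    using f unfolding realizes_def by blast+
  obtain p' R where S': "side_surface (insert p' (insert R (f ` (?V - {u}))))"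
    and new: "p' \<notin> f ` (?V - {u})" and p'v: "conv p' \<inter> conv (f v) = {}"
    and p': "\<forall>a\<in>?V - {u, v}. conv p' \<inter> conv (f a) \<noteq> {} \<longleftrightarrow> (u, a) \<in> parcs G"
    by (rule realizes_cut_edge[OF f uv]) (rule that; assumption)
  let ?f = "f(u := p')"
  have "realizes ?f \<lparr>pverts = ?V, parcs = parcs G - {(u, v), (v, u)}\<rparr>"
    unfolding realizes_def pair_pre_digraph.simps
  proof (intro conjI ballI impI)
    show "inj_on ?f ?V"
      using inj new by (auto simp: inj_on_def)
    have "?f ` ?V \<subseteq> insert p' (insert R (f ` (?V - {u})))"
      by auto
    then show "side_surface (?f ` ?V)"
      by (rule side_surface_subset[OF S'])
    fix a b assume ab: "a \<in> ?V" "b \<in> ?V" "a \<noteq> b"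
    consider "a = u" "b = v" | "a = v" "b = u" | "a = u" "b \<noteq> v" | "b = u" "a \<noteq> v" | "a \<noteq> u" "b \<noteq> u"
      by blast
    then show "(a, b) \<in> parcs G - {(u, v), (v, u)} \<longleftrightarrow> conv (?f a) \<inter> conv (?f b) \<noteq> {}"
    proof cases
      case 1
      then show ?thesis using p'v ab by simp
    next
      case 2
      then show ?thesis using p'v ab by (simp add: Int_commute)
    next
      case 3
      then show ?thesis using p' ab by simp
    next
      case 4
      then show ?thesis
        using p' ab realizes_symmetric[OF f ab] by (simp add: Int_commute)
    next
      case 5
      then show ?thesis using adj[OF ab] by simp
    qed
  qed
  then show ?thesis
    by blast
qed

text \<open>A single deletion removes an arc together with its reverse, which is why the converse of
  \<open>D\<close> appears.\<close>

lemma realizes_delete_edges: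
  assumes "finite D" "realizes f G"
  shows "\<exists>f'. realizes f' \<lparr>pverts = pverts G, parcs = parcs G - (D \<union> D\<inverse>)\<rparr>"
  using assms(1)
proof induction
  case empty
  then show ?case
    using assms(2) by (intro exI[of _ f]) (simp add: realizes_def)
next
  case (insert d D)
  obtain u v where "d = (u, v)"
    by fastforce
  then have "parcs G - (D \<union> D\<inverse>) - {(u, v), (v, u)} = parcs G - (insert d D \<union> (insert d D)\<inverse>)"
    by auto
  moreover obtain f' where "realizes f' \<lparr>pverts = pverts G, parcs = parcs G - (D \<union> D\<inverse>)\<rparr>"
    using insert.IH by blast
  ultimately show ?case
    using realizes_delete_edge[of f' "\<lparr>pverts = pverts G, parcs = parcs G - (D \<union> D\<inverse>)\<rparr>" u v] by simp
qed

text \<open>The surplus edges are removed while all vertices are still present; afterwards leaving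
  out the polygons of the surplus vertices requires no cut.\<close>

lemma realizes_subgraph:
  assumes f: "realizes f G" and G: "pair_graph G" and H: "pair_graph H"
    and sub: "subgraph (with_proj H) (with_proj G)"
  shows "\<exists>f'. realizes f' H"
proof -
  interpret G: pair_graph G by fact
  interpret H: pair_graph H by fact
  have verts: "pverts H \<subseteq> pverts G" and arcs: "parcs H \<subseteq> parcs G"
    using sub unfolding subgraph_def by auto
  let ?D = "parcs G - parcs H"
  have "finite ?D"
    using G.pair_finite_arcs by simp
  then obtain f' where f': "realizes f' \<lparr>pverts = pverts G, parcs = parcs G - (?D \<union> ?D\<inverse>)\<rparr>"
    using realizes_delete_edges[OF _ f] by blast
  \<comment> \<open>Removing reverses takes nothing from \<open>H\<close>, because with every arc
    its reverse is in \<open>H\<close>, too.\<close>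
  have "parcs G - (?D \<union> ?D\<inverse>) = parcs H"
    using arcs H.arcs_symmetric by auto
  then have "realizes f' H"
    using verts by (intro realizes_restrict[OF f']) auto
  then show ?thesis
    by blast
qed

text \<open>The vertex \<open>u\<close> gets the remainder \<open>p'\<close> and the new vertex
  \<open>w\<close> the strip \<open>R\<close>. The contacts of \<open>R\<close> with
  \<open>p'\<close> and with \<open>f v\<close> are the two new edges, and the cut itself removes
  the old one.\<close>

lemma realizes_subdivide:
  assumes f: "realizes f G" and G: "pair_bidirected_digraph G" and e: "e \<in> parcs G" and w: "w \<notin> pverts G"
  shows "\<exists>f'. realizes f' (subdivide G e w)"
proof -
  interpret pair_bidirected_digraph G by fact
  obtain u v where euv: "e = (u, v)"
    by fastforce
  then have uv: "u \<in> pverts G" "v \<in> pverts G" "u \<noteq> v" "(u, v) \<in> parcs G"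
    using e in_arcsD1 in_arcsD2 no_loops' by blast+
  let ?V = "pverts G"
  have inj: "inj_on f ?V"
    and adj: "\<And>a b. a \<in> ?V \<Longrightarrow> b \<in> ?V \<Longrightarrow> a \<noteq> b \<Longrightarrow>
      (a, b) \<in> parcs G \<longleftrightarrow> conv (f a) \<inter> conv (f b) \<noteq> {}"
    using f unfolding realizes_def by blast+
  obtain p' R where S': "side_surface (insert p' (insert R (f ` (?V - {u}))))"
    and new: "p' \<notin> f ` (?V - {u})" "R \<notin> f ` (?V - {u})" "p' \<noteq> R" and p'R: "conv p' \<inter> conv R \<noteq> {}"
    and p'v: "conv p' \<inter> conv (f v) = {}"
    and R: "\<forall>a\<in>?V - {u}. conv R \<inter> conv (f a) \<noteq> {} \<longleftrightarrow> a = v"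
    and p': "\<forall>a\<in>?V - {u, v}. conv p' \<inter> conv (f a) \<noteq> {} \<longleftrightarrow> (u, a) \<in> parcs G"
    by (rule realizes_cut_edge[OF f uv]) (rule that; assumption)
  let ?f = "f(u := p', w := R)" and ?H = "subdivide G (u, v) w"
  have w': "w \<noteq> u" "w \<noteq> v" "(a, w) \<notin> parcs G" "(w, a) \<notin> parcs G" for a
    using w uv in_arcsD1 in_arcsD2 by blast+
  have "realizes ?f ?H"
    unfolding realizes_def
  proof (intro conjI ballI impI)
    show "inj_on ?f (pverts ?H)"
      using inj new w w' by (auto simp: inj_on_def)
    have "?f ` pverts ?H \<subseteq> insert p' (insert R (f ` (?V - {u})))"
      using w by auto
    then show "side_surface (?f ` pverts ?H)"
      by (rule side_surface_subset[OF S'])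
    \<comment> \<open>Only pairs with the changed polygon in front are computed, \<open>w\<close>
      before \<open>u\<close>; the symmetry of arcs and of intersection supplies the reversed
      pairs.\<close>
    have half: "(a, b) \<in> parcs ?H \<longleftrightarrow> conv (?f a) \<inter> conv (?f b) \<noteq> {}"
      if ab: "a \<in> insert w ?V" "b \<in> ?V" "a \<noteq> b" "a = w \<or> b \<noteq> u" for a b
    proof -
      consider "a = w" "b = u" | "a = w" "b \<noteq> u" | "a = u" "b = v" | "a = u" "b \<noteq> v" | "a \<noteq> w" "a \<noteq> u"
        by blast
      then show ?thesis
      proof cases
        case 1
        then show ?thesis using p'R w' by (simp add: Int_commute)
      next
        case 2
        then have "b \<noteq> w"
          using ab by blast
        then show ?thesis using R 2 ab w' by auto
      next
        case 3
        then show ?thesis using p'v uv w' by simp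
      next
        case 4
        then have "b \<noteq> w"
          using ab w by blast
        then show ?thesis using p' 4 ab w' by simp
      next
        case 5
        then have "a \<in> ?V" "b \<noteq> w" "b \<noteq> u"
          using ab w by auto
        then show ?thesis using adj[of a b] 5 ab by simp
      qed
    qed
    have sym: "(a, b) \<in> parcs ?H \<longleftrightarrow> (b, a) \<in> parcs ?H" for a b
      using arcs_symmetric[of a b] arcs_symmetric[of b a] by auto
    fix a b assume ab: "a \<in> pverts ?H" "b \<in> pverts ?H" "a \<noteq> b"
    show "(a, b) \<in> parcs ?H \<longleftrightarrow> conv (?f a) \<inter> conv (?f b) \<noteq> {}"
    proof (cases "b \<in> ?V \<and> (a = w \<or> b \<noteq> u)")
      case True
      then show ?thesis
        using half[of a b] ab by simp
    next
      case False
      then have "a \<in> ?V" "b = w \<or> a \<noteq> u" "b \<in> insert w ?V"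
        using ab by auto
      then have "(b, a) \<in> parcs ?H \<longleftrightarrow> conv (?f b) \<inter> conv (?f a) \<noteq> {}"
        using half[of b a] ab(3) by blast
      then show ?thesis
        unfolding sym[of a b] by (simp only: Int_commute)
    qed
  qed
  then show ?thesis
    unfolding euv by blast
qed

lemma realizes_subdivision:
  assumes "subdivision_pair G H" "realizes f G"
  shows "\<exists>f'. realizes f' H"
  using assms(1)
proof (induction rule: subdivision_pair_induct)
  case base
  then show ?case
    using assms(2) by blast
next
  case (divide e w H)
  then obtain f' where "realizes f' H"
    by blast
  then show ?case
    by (rule realizes_subdivide[OF _ bidirected_digraphI_subdivision[OF divide.hyps(3)] divide.hyps(1,2)])
qed

theorem proposition3:
  fixes G :: "'a pair_pre_digraph"
  assumes "pair_graph G" and "convex_surface_graph G"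
  shows "(\<forall>H. pair_graph H \<and> subgraph (with_proj H) (with_proj G) \<longrightarrow> convex_surface_graph H) \<and>
         (\<forall>H. subdivision_pair G H \<longrightarrow> convex_surface_graph H)"
proof (intro conjI allI impI)
  obtain f where f: "realizes f G"
    using assms convex_surface_graph_iff_realizes by blast
  fix H :: "'a pair_pre_digraph"
  show "convex_surface_graph H" if "pair_graph H \<and> subgraph (with_proj H) (with_proj G)"
    using that realizes_subgraph[OF f assms(1)] convex_surface_graph_iff_realizes by blast
  show "convex_surface_graph H" if "subdivision_pair G H"
    using realizes_subdivision[OF that f] convex_surface_graph_iff_realizes
      pair_graph.pair_graph_subdivision[OF assms(1) that] by blast
qed

end
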